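(* Let $\mathbb F_1$ and $\mathbb F_2$ be two finite fields with $|\mathbb F_1|=q_1$ and $|\mathbb F_2|=q_2$, let $m,n,k,l\geq1$, let $A$ be an $n\times m$ matrix over $\mathbb F_1$ of rank $r$, and let $B$ be an $l\times k$ matrix over $\mathbb F_2$ of rank $s$. The following are equivalent: (i) $\mathcal M_{mn}^A(\mathbb F_1)\cong\mathcal M_{kl}^B(\mathbb F_2)$; (ii) one of the following holds: (a) $r=s=0$ and $q_1^{mn}=q_2^{kl}$; or (b) $r=s\geq1$, $(m,n)=(k,l)$, and $q_1=q_2$. Further, if $r\geq1$, then $\mathcal M_{mn}^A(\mathbb F_1)\cong\mathcal M_{kl}^B(\mathbb F_2)$ if and only if $\operatorname{Reg}(\mathcal M_{mn}^A(\mathbb F_1))\cong\operatorname{Reg}(\mathcal M_{kl}^B(\mathbb F_2))$.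
   Context: For a field $\mathbb F$, $\mathcal M_{mn}(\mathbb F)$ is the set of all $m\times n$ matrices over $\mathbb F$. For an $n\times m$ matrix $A$ over $\mathbb F$, the linear sandwich semigroup $\mathcal M_{mn}^A(\mathbb F)$ has underlying set $\mathcal M_{mn}(\mathbb F)$ and operation $X\star_AY=XAY$. $\operatorname{Reg}(T)$ denotes the set of regular elements of a semigroup $T$ (those $x$ with $x=xyx$ for some $y\in T$); for linear sandwich semigroups it is a subsemigroup. Isomorphism $\cong$ is isomorphism of semigroups. *)

theory Defs
  imports "Jordan_Normal_Form.DL_Rank"
begin

(* HOL-Algebra has no carrier-based semigroups (its record monoid carries a distinguished unit). *)
record 'a semigrp = "'a partial_object" +
  op :: "'a \<Rightarrow> 'a \<Rightarrow> 'a"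

locale semigrp =
  fixes S :: "'a semigrp"
  assumes op_closed: "x \<in> carrier S \<Longrightarrow> y \<in> carrier S \<Longrightarrow> op S x y \<in> carrier S"
    and op_assoc: "x \<in> carrier S \<Longrightarrow> y \<in> carrier S \<Longrightarrow> z \<in> carrier S \<Longrightarrow>
      op S (op S x y) z = op S x (op S y z)"

definition semigrp_iso :: "'a semigrp \<Rightarrow> 'b semigrp \<Rightarrow> bool" (infix \<open>\<cong>\<^sub>s\<close> 50) where
  "S \<cong>\<^sub>s T \<longleftrightarrow> (\<exists>h. bij_betw h (carrier S) (carrier T) \<and>
     (\<forall>x\<in>carrier S. \<forall>y\<in>carrier S. h (op S x y) = op T (h x) (h y)))"

definition Reg :: "'a semigrp \<Rightarrow> 'a semigrp" where
  "Reg S = S\<lparr>carrier := {x \<in> carrier S. \<exists>y\<in>carrier S. x = op S (op S x y) x}\<rparr>"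

(* The semigroup of m x n matrices; the sandwich matrix A is meant to be n x m. *)
definition sandwich :: "nat \<Rightarrow> nat \<Rightarrow> 'a::field mat \<Rightarrow> 'a mat semigrp" where
  "sandwich m n A = \<lparr>carrier = carrier_mat m n, op = (\<lambda>X Y. X * A * Y)\<rparr>"

lemma semigrp_sandwich:
  assumes A: "A \<in> carrier_mat n m"
  shows "semigrp (sandwich m n A)"
proof
  fix X Y assume "X \<in> carrier (sandwich m n A)" "Y \<in> carrier (sandwich m n A)"
  then show "op (sandwich m n A) X Y \<in> carrier (sandwich m n A)"
    using A by (auto simp: sandwich_def)
next
  fix X Y Z
  assume "X \<in> carrier (sandwich m n A)" "Y \<in> carrier (sandwich m n A)"
    "Z \<in> carrier (sandwich m n A)"
  then have X: "X \<in> carrier_mat m n" and Y: "Y \<in> carrier_mat m n" and Z: "Z \<in> carrier_mat m n"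
    by (auto simp: sandwich_def)
  have XA: "X * A \<in> carrier_mat m m" and YA: "Y * A \<in> carrier_mat m m"
    using X Y A by auto
  have "X * A * Y * A * Z = X * A * (Y * A * Z)"
    using assoc_mult_mat[OF XA Y A] assoc_mult_mat[OF XA YA Z] by simp
  then show "op (sandwich m n A) (op (sandwich m n A) X Y) Z
      = op (sandwich m n A) X (op (sandwich m n A) Y Z)"
    by (simp add: sandwich_def)
qed

end

theory Submission
  imports Defs "HOL-Library.Cardinality" "HOL-Algebra.Multiplicative_Group" "HOL-Algebra.Sylow"
    "HOL-Number_Theory.Residues"
begin

text \<open>Row and column operations bring A to the normal form J with r ones on the diagonal, and
  equivalent sandwich matrices give isomorphic semigroups; together with the uniqueness of finite
  fields this shows that the data in (ii) determine the semigroup.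

  Conversely, put R = Reg(S), write A' for the transpose of A, and let e run over the nonzero idempotents
  of R. If u is a nonzero column of e, then e fixes every outer product u w', and R contains u w' whenever
  A' w is nonzero; hence eR is at least as large as the set of all w with A' w nonzero, together with 0,
  and equality holds for some e of rank one. So the minimum of |eR| is q^n - q^(n-r) + 1, dually that of
  |Re| is q^m - q^(m-r) + 1, and that of |eRe| is q. These minima are isomorphism invariants, and
  they determine q, r, m and n.\<close>

section \<open>Uniqueness of finite fields\<close>

text \<open>An isomorphism sees only the multiplication, so rank, dimensions and field size must be
  read off from products. Ideals generated by idempotents allow this, but their sizes vary with the
  idempotent; minima remove the choice. The number q^n - q^(n-r) + 1 counts all vectors of length n
  except the nonzero ones in the kernel of A', a kernel of dimension n - r. Divisibility by q
  recovers n - r and n from it as soon as r \<ge> 1; for r = 0 the powers cancel and nothing about n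
  is left. Hence the separate case: if A = 0, all products vanish, the regular part is {0}, and only
  the cardinality of the semigroup matters.

  The minima are never formed. A lower bound valid for every nonzero idempotent of one semigroup is
  set against an upper bound at a chosen idempotent of the other, and exchanging the two sides turns
  the inequalities into equalities. The rank enters solely through the number q^r of vectors in the
  column space, which identifies it with the number of ones in the normal form.\<close>

lemma finite_field_power_card:
  fixes x :: "'a::{field,finite}"
  shows "x ^ CARD('a) = x"
proof (cases "x = 0")
  case True
  then show ?thesis by simp
next
  case False
  let ?R = "class_ring :: 'a ring"
  have f: "field ?R" by (rule class_field)
  interpret G: group "mult_of ?R" by (rule field.field_mult_group[OF f])
  have pow: "y [^]\<^bsub>mult_of ?R\<^esub> i = y ^ i" for y and i :: nat
    by (simp add: nat_pow_mult_of class_ring_simps)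
  have "Coset.order (mult_of ?R) = CARD('a) - 1"
    by (simp add: Coset.order_def card_Diff_singleton)
  with G.pow_order_eq_1[of x] False have "x ^ (CARD('a) - 1) = 1"
    by (simp add: pow)
  then have "x * x ^ (CARD('a) - 1) = x" by simp
  then show ?thesis
    by (metis power_Suc Suc_pred' zero_less_card_finite)
qed

text \<open>The group of units is cyclic. A generator \<open>a\<close> makes every field element the
  value at \<open>a\<close> of an integer polynomial, namely of 0 or of a monomial; this is how a
  map out of the field is defined below.\<close>

lemma finite_field_primitive_element:
  obtains a :: "'a::{field,finite}" where "\<And>x. x \<noteq> 0 \<Longrightarrow> \<exists>i. x = a ^ i"
proof -
  let ?R = "class_ring :: 'a ring"
  have pow: "y [^]\<^bsub>?R\<^esub> i = y ^ i" for y and i :: nat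
    by (simp add: class_ring_simps)
  have "\<exists>a \<in> carrier (mult_of ?R). carrier (mult_of ?R) = {a [^]\<^bsub>?R\<^esub> i | i::nat. i \<in> UNIV}"
    by (rule field.finite_field_mult_group_has_gen[OF class_field]) simp
  then obtain a where a: "carrier (mult_of ?R) = {a [^]\<^bsub>?R\<^esub> i | i::nat. i \<in> UNIV}"
    by blast
  have "\<exists>i. x = a ^ i" if "x \<noteq> 0" for x
  proof -
    have "x \<in> carrier (mult_of ?R)" using that by simp
    then show ?thesis unfolding a by (auto simp: pow)
  qed
  then show thesis using that by blast
qed

lemma finite_field_prime_CHAR: "prime CHAR('a::{field,finite})"
  by (rule prime_CHAR_semidom) (simp add: finite_imp_CHAR_pos)

text \<open>Cauchy's theorem, obtained from Sylow's theorem with exponent 1, gives x \<noteq> 0 with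
  l x = 0, so the characteristic divides \<open>l\<close>. The purpose is that equal cardinality
  forces equal characteristic.\<close>

lemma prime_dvd_card_finite_field:
  assumes "prime l" and "l dvd CARD('a::{field,finite})"
  shows "l = CHAR('a)"
proof -
  let ?G = "add_monoid (class_ring :: 'a ring)"
  have G: "group ?G"
  proof (rule groupI)
    fix x :: 'a
    show "\<exists>y\<in>carrier ?G. y \<otimes>\<^bsub>?G\<^esub> x = \<one>\<^bsub>?G\<^esub>" if "x \<in> carrier ?G"
      by (rule bexI[of _ "- x"]) auto
  qed (auto simp: add.assoc)
  interpret G: group ?G by (rule G)
  have pow: "y [^]\<^bsub>?G\<^esub> i = of_nat i * y" for y and i :: nat
    by (induction i) (simp_all add: nat_pow_def algebra_simps)
  obtain k where k: "CARD('a) = l * k" using assms(2) by blast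
  obtain H where H: "subgroup H ?G" "card H = l"
    using sylow_thm[OF assms(1) G, of 1 k] k by (auto simp: Coset.order_def)
  have "1 < card H" using H assms(1) prime_gt_1_nat by auto
  then obtain x where x: "x \<in> H" "x \<noteq> 0"
    by (metis One_nat_def card_le_Suc0_iff_eq card.infinite not_less not_less_zero
        zero_less_one)
  interpret H: group "?G\<lparr>carrier := H\<rparr>"
    by (rule G.subgroup_imp_group[OF H(1)])
  have "x [^]\<^bsub>?G\<lparr>carrier := H\<rparr>\<^esub> l = 0"
    using H.pow_order_eq_1[of x] x H(2) by (simp add: Coset.order_def)
  then have "x [^]\<^bsub>?G\<^esub> l = 0"
    by (simp add: nat_pow_def)
  then have "of_nat l = (0::'a)" using x unfolding pow by simp
  then have "CHAR('a) dvd l" by (simp add: of_nat_eq_0_iff_char_dvd)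
  then show ?thesis
    using assms(1) finite_field_prime_CHAR[where 'a = 'a] primes_dvd_imp_eq by blast
qed

section \<open>Evaluation of integer polynomials in finite fields\<close>

text \<open>Integer coefficients map into every field, so one polynomial has values in both fields
  although these are distinct types.\<close>

definition int_poly_eval :: "'a::field \<Rightarrow> int poly \<Rightarrow> 'a" where
  "int_poly_eval a g = poly (map_poly of_int g) a"

lemma map_poly_of_int_mult:
  "map_poly of_int (f * g) = (map_poly of_int f * map_poly of_int g :: 'a::field poly)"
  by (rule poly_eqI) (simp add: coeff_map_poly coeff_mult)

lemma map_poly_of_int_add:
  "map_poly of_int (f + g) = (map_poly of_int f + map_poly of_int g :: 'a::field poly)"
  by (rule poly_eqI) (simp add: coeff_map_poly)

lemma map_poly_of_int_diff:
  "map_poly of_int (f - g) = (map_poly of_int f - map_poly of_int g :: 'a::field poly)"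
  by (rule poly_eqI) (simp add: coeff_map_poly)

lemma map_poly_of_int_monom:
  "map_poly of_int (Polynomial.monom c i) = (Polynomial.monom (of_int c) i :: 'a::field poly)"
  by (rule poly_eqI) (simp add: coeff_map_poly)

lemma int_poly_eval_hom:
  "int_poly_eval a 0 = 0"
  "int_poly_eval a (f * g) = int_poly_eval a f * int_poly_eval a g"
  "int_poly_eval a (f + g) = int_poly_eval a f + int_poly_eval a g"
  "int_poly_eval a (f - g) = int_poly_eval a f - int_poly_eval a g"
  "int_poly_eval a (Polynomial.monom 1 i) = a ^ i"
  by (simp_all add: int_poly_eval_def map_poly_of_int_mult map_poly_of_int_add
      map_poly_of_int_diff map_poly_of_int_monom poly_monom)

text \<open>The right side depends on the field only through its characteristic; this carries the
  vanishing of a reduced polynomial from one field to the other.\<close>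

lemma map_poly_of_int_eq_0_iff:
  "map_poly of_int g = (0 :: 'a::field poly) \<longleftrightarrow> (\<forall>i. int CHAR('a) dvd Polynomial.coeff g i)"
  by (auto simp: poly_eq_iff coeff_map_poly of_int_eq_0_iff_char_dvd)

lemma degree_map_poly_le:
  assumes "f 0 = 0"
  shows "degree (map_poly f g) \<le> degree g"
  by (rule degree_le) (simp add: assms coeff_map_poly coeff_eq_0)

text \<open>The coefficients are reduced modulo the characteristic twice. The first reduction
  removes leading terms that vanish in the field; then the polynomial is multiplied by an inverse
  \<open>u\<close> of the remaining leading coefficient, and the second reduction makes that
  coefficient literally 1.\<close>

lemma monic_int_poly_of_annihilator:
  fixes a :: "'a::{field,finite}"
  assumes "int_poly_eval a g = 0" and "map_poly of_int g \<noteq> (0 :: 'a poly)"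
  obtains h where "lead_coeff h = 1" and "degree h \<le> degree g" and "int_poly_eval a h = 0"
proof -
  define p where "p = int CHAR('a)"
  have prime: "prime p" unfolding p_def using finite_field_prime_CHAR by simp
  then have p1: "p > 1" using prime_gt_1_int by blast
  have of_int_mod: "of_int (c mod p) = (of_int c :: 'a)" for c
  proof -
    have "(of_int (p * (c div p) + c mod p) :: 'a) = of_int p * of_int (c div p) + of_int (c mod p)"
      by (simp only: of_int_add of_int_mult)
    then show ?thesis by (simp add: p_def)
  qed
  define g1 where "g1 = map_poly (\<lambda>c. c mod p) g"
  have g1: "map_poly of_int g1 = (map_poly of_int g :: 'a poly)"
    by (rule poly_eqI) (simp add: g1_def coeff_map_poly of_int_mod)
  with assms(2) have "g1 \<noteq> 0" by auto
  define c where "c = lead_coeff g1"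
  have c: "c \<noteq> 0" using \<open>g1 \<noteq> 0\<close> by (simp add: c_def)
  \<comment> \<open>The leading coefficient of \<open>g1\<close> is nonzero and already reduced, so
    \<open>p\<close> cannot divide it.\<close>
  have "c = c mod p" by (simp add: c_def g1_def coeff_map_poly)
  with c have "\<not> p dvd c" by (metis dvd_imp_mod_0)
  then have "coprime c p"
    using prime_imp_coprime[OF prime, of c] by (simp add: coprime_commute)
  then obtain u where u: "(c * u) mod p = 1"
    using cong_solve_coprime_int[of c p] p1 by (auto simp: cong_def)
  define h where "h = map_poly (\<lambda>c. (c * u) mod p) g1"
  have ch: "Polynomial.coeff h i = (Polynomial.coeff g1 i * u) mod p" for i
    by (simp add: h_def coeff_map_poly)
  have deg: "degree h = degree g1"
  proof (rule antisym)
    show "degree h \<le> degree g1"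
      unfolding h_def by (rule degree_map_poly_le) simp
    show "degree g1 \<le> degree h"
      by (rule le_degree) (use u in \<open>simp add: ch c_def\<close>)
  qed
  have "map_poly of_int h = (Polynomial.smult (of_int u) (map_poly of_int g) :: 'a poly)"
    unfolding g1[symmetric] by (rule poly_eqI) (simp add: ch coeff_map_poly of_int_mod mult.commute)
  then have "int_poly_eval a h = of_int u * int_poly_eval a g"
    by (simp add: int_poly_eval_def)
  moreover have "lead_coeff h = 1" using u by (simp add: deg ch c_def)
  moreover have "degree h \<le> degree g"
    unfolding deg g1_def by (rule degree_map_poly_le) simp
  ultimately show thesis using that assms(1) by simp
qed

text \<open>Pseudo-division scales the dividend by a power of the leading coefficient of the
  divisor. For a monic divisor it is therefore division with remainder over the integers.\<close>

lemma monic_int_poly_division: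
  fixes f g :: "int poly"
  assumes "lead_coeff f = 1"
  obtains h r where "g = f * h + r" and "r = 0 \<or> degree r < degree f"
proof -
  obtain h r where "pseudo_divmod g f = (h, r)" by fastforce
  moreover have "f \<noteq> 0" using assms by auto
  ultimately show thesis
    using that pseudo_divmod[of f g h r] assms by simp
qed

text \<open>A monic integer polynomial of minimal degree vanishing at a primitive element a replaces the
  minimal polynomial of a over the prime field, for which there is no type.\<close>

lemma common_root_transfer:
  fixes a :: "'a::{field,finite}"
  assumes card: "CARD('a) = CARD('b::{field,finite})"
  obtains b :: "'b::{field,finite}" where "\<And>g. int_poly_eval a g = 0 \<Longrightarrow> int_poly_eval b g = 0"
proof -
  have char: "CHAR('a) = CHAR('b)"
    using prime_dvd_card_finite_field[where 'a = 'b, of "CHAR('a)"] finite_field_prime_CHAR[where 'a = 'a]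
      CHAR_dvd_CARD[where 'a = 'a] card by simp
  define q where "q = CARD('a)"
  have "card {0, 1 :: 'a} \<le> CARD('a)" by (rule card_mono) auto
  then have q: "q > 1" by (simp add: q_def)
  \<comment> \<open>With \<open>q\<close> the common cardinality, every element of either field is a
    root of x^q - x.\<close>
  define X :: "int poly" where "X = Polynomial.monom 1 q - Polynomial.monom 1 1"
  have coeff_X: "Polynomial.coeff X i = (if i = q then 1 else if i = 1 then -1 else 0)" for i
    using q by (auto simp: X_def)
  have degX: "degree X = q"
    by (rule antisym) (use q in \<open>auto intro!: degree_le le_degree simp: coeff_X\<close>)
  have Xa: "int_poly_eval a X = 0"
    by (simp add: X_def int_poly_eval_hom finite_field_power_card q_def del: One_nat_def)
  have Xb: "int_poly_eval b X = 0" for b :: 'b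
    by (simp add: X_def int_poly_eval_hom finite_field_power_card q_def card del: One_nat_def)
  define P where "P f \<longleftrightarrow> lead_coeff f = 1 \<and> int_poly_eval a f = 0" for f
  have "P X" using Xa by (simp add: P_def degX coeff_X)
  then obtain f where f: "P f" and min: "\<And>g. P g \<Longrightarrow> degree f \<le> degree g"
    using exists_least_iff[of "\<lambda>d. \<exists>f. P f \<and> degree f = d"] by (metis leI)
  have lead: "lead_coeff f = 1" and fa: "int_poly_eval a f = 0" using f by (auto simp: P_def)
  have degf: "degree f > 0"
  proof (rule ccontr)
    assume "\<not> degree f > 0"
    then obtain c where "f = [:c:]" using degree_eq_zeroE by blast
    then have "f = Polynomial.monom 1 0" using lead by (simp add: monom_0)
    then show False using fa int_poly_eval_hom(5)[of a 0] by simp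
  qed
  \<comment> \<open>A remainder that is nonzero over the second field is nonzero over the first as
    well, the characteristics being equal; its monic replacement would then violate the minimality
    of the degree of \<open>f\<close>.\<close>
  have small: "map_poly of_int r = (0 :: 'b poly)"
    if "int_poly_eval a r = 0" "r = 0 \<or> degree r < degree f" for r
  proof (rule ccontr)
    assume *: "map_poly of_int r \<noteq> (0 :: 'b poly)"
    then have "map_poly of_int r \<noteq> (0 :: 'a poly)"
      by (simp add: map_poly_of_int_eq_0_iff char)
    from monic_int_poly_of_annihilator[OF that(1) this] obtain h
      where "lead_coeff h = 1" "degree h \<le> degree r" "int_poly_eval a h = 0" by blast
    then show False using min[of h] that(2) * by (auto simp: P_def)
  qed
  have split: "\<exists>h. map_poly of_int g = (map_poly of_int f * map_poly of_int h :: 'b poly)"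
    if g: "int_poly_eval a g = 0" for g
  proof -
    obtain h r where h: "g = f * h + r" "r = 0 \<or> degree r < degree f"
      using monic_int_poly_division[OF lead] .
    have "int_poly_eval a r = 0" using g fa by (simp add: h(1) int_poly_eval_hom)
    from small[OF this h(2)] show ?thesis
      by (auto simp: h(1) map_poly_of_int_mult map_poly_of_int_add)
  qed
  \<comment> \<open>Over the second field \<open>X\<close> factors as \<open>f\<close> times some
    \<open>h\<close>. If \<open>f\<close> had no root there, all \<open>q\<close> elements would be
    roots of \<open>h\<close>, whose degree is below \<open>q\<close> because \<open>f\<close> is
    not constant.\<close>
  have "\<exists>b :: 'b. int_poly_eval b f = 0"
  proof (rule ccontr)
    assume no: "\<nexists>b :: 'b. int_poly_eval b f = 0"
    obtain h where h: "map_poly of_int X = (map_poly of_int f * map_poly of_int h :: 'b poly)"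
      using split[OF Xa] by blast
    let ?f = "map_poly of_int f :: 'b poly" and ?h = "map_poly of_int h :: 'b poly"
    have "int_poly_eval b h = 0" for b :: 'b
      using no Xb[of b] h by (simp add: int_poly_eval_def)
    then have roots: "{b. poly ?h b = 0} = UNIV" by (auto simp: int_poly_eval_def)
    have "Polynomial.coeff (?f * ?h) q = 1"
      unfolding h[symmetric] by (simp add: coeff_map_poly coeff_X)
    then have nz: "?f \<noteq> 0" "?h \<noteq> 0" by auto
    have "degree ?f \<ge> degree f"
      by (rule le_degree) (simp add: coeff_map_poly lead)
    moreover have "degree (?f * ?h) \<le> q"
      unfolding h[symmetric] using degree_map_poly_le[of "of_int :: int \<Rightarrow> 'b" X] degX by simp
    ultimately have "degree ?h < q"
      using degf nz by (simp add: degree_mult_eq)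
    moreover have "q \<le> degree ?h"
      using card_poly_roots_bound[OF nz(2)] roots by (simp add: q_def card)
    ultimately show False by simp
  qed
  then obtain b :: 'b where b: "int_poly_eval b f = 0" by blast
  have "int_poly_eval b g = 0" if "int_poly_eval a g = 0" for g
    using split[OF that] b by (auto simp: int_poly_eval_def)
  then show thesis using that by blast
qed

text \<open>The map sends g(a) to g(b) for integer polynomials g. It is total because
  \<open>a\<close> is primitive and well defined because every relation at \<open>a\<close> holds at
  \<open>b\<close>. A nonzero difference has an inverse, so its image is nonzero, which gives
  injectivity; counting gives surjectivity.\<close>

lemma finite_field_iso:
  assumes card: "CARD('a::{field,finite}) = CARD('b::{field,finite})"
  obtains \<phi> :: "'a::{field,finite} \<Rightarrow> 'b::{field,finite}" where "bij \<phi>" and "\<And>x y. \<phi> (x + y) = \<phi> x + \<phi> y"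
    and "\<And>x y. \<phi> (x * y) = \<phi> x * \<phi> y"
proof -
  obtain a :: 'a where a: "\<And>x. x \<noteq> 0 \<Longrightarrow> \<exists>i. x = a ^ i"
    using finite_field_primitive_element by blast
  obtain b :: 'b where b: "\<And>g. int_poly_eval a g = 0 \<Longrightarrow> int_poly_eval b g = 0"
    using common_root_transfer[OF card] by blast
  have b': "int_poly_eval b g = int_poly_eval b h" if "int_poly_eval a g = int_poly_eval a h" for g h
    using b[of "g - h"] that by (simp add: int_poly_eval_hom)
  have "\<exists>g. int_poly_eval a g = x" for x
    using a[of x] int_poly_eval_hom(1)[of a] int_poly_eval_hom(5)[of a] by (cases "x = 0") metis+
  then obtain G where G: "\<And>x. int_poly_eval a (G x) = x" by metis
  define \<phi> where "\<phi> x = int_poly_eval b (G x)" for x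
  have \<phi>: "\<phi> x = int_poly_eval b g" if "int_poly_eval a g = x" for x g
    unfolding \<phi>_def by (rule b') (simp add: G that)
  have add: "\<phi> (x + y) = \<phi> x + \<phi> y" for x y
    by (subst \<phi>[of "G x + G y"]) (simp_all add: int_poly_eval_hom G \<phi>_def)
  have mult: "\<phi> (x * y) = \<phi> x * \<phi> y" for x y
    by (subst \<phi>[of "G x * G y"]) (simp_all add: int_poly_eval_hom G \<phi>_def)
  have one: "\<phi> 1 = 1"
    using \<phi>[of 1 1] int_poly_eval_hom(5)[of a 0] int_poly_eval_hom(5)[of b 0] by simp
  have zero: "\<phi> 0 = 0" by (metis add add.right_neutral add_left_cancel)
  have "inj \<phi>"
  proof (rule injI, rule ccontr)
    fix x y assume eq: "\<phi> x = \<phi> y" and ne: "x \<noteq> y"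
    have "\<phi> (x - y) = 0" using add[of "x - y" y] eq by simp
    moreover have "\<phi> (x - y) * \<phi> (inverse (x - y)) = 1"
      using ne one by (simp flip: mult)
    ultimately show False by simp
  qed
  then have "bij \<phi>"
    by (simp add: bij_def card card_subset_eq card_image)
  then show thesis using that add mult by blast
qed

section \<open>Equivalence of matrices and rank\<close>

text \<open>The inverses belong to the witness: they yield symmetry directly, and later the inverse
  of the map that an equivalence induces on sandwich semigroups.\<close>

definition mat_equiv :: "nat \<Rightarrow> nat \<Rightarrow> 'a::field mat \<Rightarrow> 'a mat \<Rightarrow> bool" where
  "mat_equiv n m A B \<longleftrightarrow> A \<in> carrier_mat n m \<and> B \<in> carrier_mat n m \<and>
     (\<exists>U U' V V'. U \<in> carrier_mat n n \<and> U' \<in> carrier_mat n n \<and> V \<in> carrier_mat m m \<and>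
       V' \<in> carrier_mat m m \<and> U * U' = 1\<^sub>m n \<and> U' * U = 1\<^sub>m n \<and> V * V' = 1\<^sub>m m \<and>
       V' * V = 1\<^sub>m m \<and> A = U * B * V)"

lemma mat_equiv_refl: "A \<in> carrier_mat n m \<Longrightarrow> mat_equiv n m A A"
  unfolding mat_equiv_def
  by (intro conjI exI[of _ "1\<^sub>m n"] exI[of _ "1\<^sub>m m"]) auto

lemma mat_equiv_leftI:
  fixes A :: "'a::field mat"
  assumes "A \<in> carrier_mat n m" "P \<in> carrier_mat n n" "P' \<in> carrier_mat n n"
    and "P * P' = 1\<^sub>m n" "P' * P = 1\<^sub>m n"
  shows "mat_equiv n m A (P * A)"
  unfolding mat_equiv_def
proof (intro conjI exI)
  show "A = P' * (P * A) * 1\<^sub>m m"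
    using assms by (simp add: assoc_mult_mat[symmetric, of P' n n P n A m])
  show "1\<^sub>m m * 1\<^sub>m m = (1\<^sub>m m :: 'a mat)" "1\<^sub>m m * 1\<^sub>m m = (1\<^sub>m m :: 'a mat)" by simp_all
qed (use assms in auto)

lemma mat_equiv_sym:
  assumes "mat_equiv n m A B"
  shows "mat_equiv n m B A"
proof -
  obtain U U' V V' where *: "A \<in> carrier_mat n m" "B \<in> carrier_mat n m" "U \<in> carrier_mat n n"
    "U' \<in> carrier_mat n n" "V \<in> carrier_mat m m" "V' \<in> carrier_mat m m" "U * U' = 1\<^sub>m n"
    "U' * U = 1\<^sub>m n" "V * V' = 1\<^sub>m m" "V' * V = 1\<^sub>m m" "A = U * B * V"
    using assms unfolding mat_equiv_def by blast
  have "U' * A * V' = U' * (U * B) * (V * V')"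
    using * by (simp add: assoc_mult_mat[of _ n n _ m _ m] assoc_mult_mat[of _ n m _ m _ m])
  also have "\<dots> = B"
    using * by (simp add: assoc_mult_mat[symmetric, of U' n n U n B m])
  finally show ?thesis using * unfolding mat_equiv_def by metis
qed

lemma mat_equiv_trans:
  assumes "mat_equiv n m A B" "mat_equiv n m B C"
  shows "mat_equiv n m A C"
proof -
  obtain U U' V V' where 1: "A \<in> carrier_mat n m" "B \<in> carrier_mat n m" "U \<in> carrier_mat n n"
    "U' \<in> carrier_mat n n" "V \<in> carrier_mat m m" "V' \<in> carrier_mat m m" "U * U' = 1\<^sub>m n"
    "U' * U = 1\<^sub>m n" "V * V' = 1\<^sub>m m" "V' * V = 1\<^sub>m m" "A = U * B * V"
    using assms(1) unfolding mat_equiv_def by blast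
  obtain P P' Q Q' where 2: "C \<in> carrier_mat n m" "P \<in> carrier_mat n n"
    "P' \<in> carrier_mat n n" "Q \<in> carrier_mat m m" "Q' \<in> carrier_mat m m" "P * P' = 1\<^sub>m n"
    "P' * P = 1\<^sub>m n" "Q * Q' = 1\<^sub>m m" "Q' * Q = 1\<^sub>m m" "B = P * C * Q"
    using assms(2) unfolding mat_equiv_def by blast
  have inv: "X * Y * (Y' * X') = 1\<^sub>m k"
    if "X \<in> carrier_mat k k" "Y \<in> carrier_mat k k" "X' \<in> carrier_mat k k" "Y' \<in> carrier_mat k k"
      "X * X' = 1\<^sub>m k" "Y * Y' = 1\<^sub>m k" for X Y X' Y' :: "'a mat" and k
  proof -
    have "X * Y * (Y' * X') = X * (Y * (Y' * X'))"
      using that by (intro assoc_mult_mat[of _ k k _ k _ k]) auto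
    also have "Y * (Y' * X') = Y * Y' * X'"
      using that by (intro assoc_mult_mat[symmetric, of _ k k _ k _ k]) auto
    finally show ?thesis using that by simp
  qed
  show ?thesis
    unfolding mat_equiv_def
  proof (intro conjI exI)
    show "U * P * (P' * U') = 1\<^sub>m n" "P' * U' * (U * P) = 1\<^sub>m n"
      "Q * V * (V' * Q') = 1\<^sub>m m" "V' * Q' * (Q * V) = 1\<^sub>m m"
      using 1 2 by (simp_all add: inv)
    show "A = U * P * C * (Q * V)"
      using 1 2 by (simp add: assoc_mult_mat[of _ n n _ n _ m] assoc_mult_mat[of _ n n _ m _ m]
          assoc_mult_mat[of _ n m _ m _ m])
  qed (use 1 2 in auto)
qed

lemma mat_equiv_transpose:
  assumes "mat_equiv n m A B"
  shows "mat_equiv m n A\<^sup>T B\<^sup>T"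
proof -
  obtain U U' V V' where *: "A \<in> carrier_mat n m" "B \<in> carrier_mat n m" "U \<in> carrier_mat n n"
    "U' \<in> carrier_mat n n" "V \<in> carrier_mat m m" "V' \<in> carrier_mat m m" "U * U' = 1\<^sub>m n"
    "U' * U = 1\<^sub>m n" "V * V' = 1\<^sub>m m" "V' * V = 1\<^sub>m m" "A = U * B * V"
    using assms unfolding mat_equiv_def by blast
  show ?thesis
    unfolding mat_equiv_def
  proof (intro conjI exI)
    show "V\<^sup>T * V'\<^sup>T = 1\<^sub>m m" "V'\<^sup>T * V\<^sup>T = 1\<^sub>m m" "U\<^sup>T * U'\<^sup>T = 1\<^sub>m n" "U'\<^sup>T * U\<^sup>T = 1\<^sub>m n"
      using * by (simp_all flip: transpose_mult)
    have "A\<^sup>T = V\<^sup>T * (U * B)\<^sup>T"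
      using * transpose_mult[of "U * B" n m V m] by simp
    also have "(U * B)\<^sup>T = B\<^sup>T * U\<^sup>T" using * transpose_mult[of U n n B m] by simp
    also have "V\<^sup>T * (B\<^sup>T * U\<^sup>T) = V\<^sup>T * B\<^sup>T * U\<^sup>T"
      using * by (simp add: assoc_mult_mat[of _ m m _ n _ n])
    finally show "A\<^sup>T = V\<^sup>T * B\<^sup>T * U\<^sup>T" .
  qed (use * in auto)
qed

section \<open>Elimination to the diagonal normal form\<close>

lemma mat_equiv_swaprows:
  assumes "A \<in> carrier_mat n m" "k < n" "l < n"
  shows "mat_equiv n m A (swaprows k l A)"
  unfolding swaprows_mat[OF assms]
  by (rule mat_equiv_leftI[of _ _ _ _ "swaprows_mat n k l"])
    (use assms in \<open>auto simp: swaprows_mat_inv\<close>)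

lemma mat_equiv_multrow:
  fixes a :: "'a::field"
  assumes "A \<in> carrier_mat n m" "k < n" "a \<noteq> 0"
  shows "mat_equiv n m A (multrow k a A)"
  unfolding multrow_mat[OF assms(1)]
  by (rule mat_equiv_leftI[of _ _ _ _ "multrow_mat n k (inverse a)"])
    (use assms multrow_mat_inv[of k n a] multrow_mat_inv[of k n "inverse a"] in auto)

text \<open>Multiples of row \<open>r\<close> are added to all other rows by a single factor
  \<open>E c\<close>, the identity with the entries of \<open>c\<close> added in column
  \<open>r\<close>. The condition on \<open>c\<close> amounts to c r = 0, which makes
  \<open>E c\<close> and its counterpart for - c inverse to each other.\<close>

lemma mat_equiv_clear_column:
  fixes A :: "'a::field mat"
  assumes A: "A \<in> carrier_mat n m" and r: "r < n"
    and one: "\<And>i. i < n \<Longrightarrow> c i = 0 \<or> i \<noteq> r"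
  shows "mat_equiv n m A (mat n m (\<lambda>(i, j). A $$ (i, j) + c i * A $$ (r, j)))"
proof -
  define E where "E d = mat n n (\<lambda>(i, j). (if i = j then 1 else 0) + (if j = r then d i else 0))"
    for d :: "nat \<Rightarrow> 'a"
  have E_mult: "E d * M = mat n k (\<lambda>(i, j). M $$ (i, j) + d i * M $$ (r, j))"
    if M: "M \<in> carrier_mat n k" for d M k
  proof (rule eq_matI)
    fix i j assume "i < dim_row (mat n k (\<lambda>(i, j). M $$ (i, j) + d i * M $$ (r, j)))"
      "j < dim_col (mat n k (\<lambda>(i, j). M $$ (i, j) + d i * M $$ (r, j)))"
    then have ij: "i < n" "j < k" by auto
    have "(E d * M) $$ (i, j) =
        (\<Sum>x\<in>{0..<n}. ((if i = x then 1 else 0) + (if x = r then d i else 0)) * M $$ (x, j))"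
      using M ij by (simp add: E_def scalar_prod_def)
    also have "\<dots> = (\<Sum>x\<in>{0..<n}. (if x = i then M $$ (x, j) else 0)) +
        (\<Sum>x\<in>{0..<n}. if x = r then d i * M $$ (x, j) else 0)"
      unfolding sum.distrib[symmetric] by (rule sum.cong) (auto simp: algebra_simps)
    finally show "(E d * M) $$ (i, j) = mat n k (\<lambda>(i, j). M $$ (i, j) + d i * M $$ (r, j)) $$ (i, j)"
      using ij r by simp
  qed (use M in \<open>auto simp: E_def\<close>)
  have E[simp]: "E d \<in> carrier_mat n n" for d by (simp add: E_def)
  have inv: "E d * E (\<lambda>i. - d i) = 1\<^sub>m n" if "\<And>i. i < n \<Longrightarrow> d i = 0 \<or> i \<noteq> r" for d
    unfolding E_mult[OF E] by (rule eq_matI) (use that r in \<open>auto simp: E_def\<close>)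
  show ?thesis
    unfolding E_mult[OF A, symmetric]
    by (rule mat_equiv_leftI[OF A E E inv]) (use one inv[of "\<lambda>i. - c i"] in auto)
qed

text \<open>The invariant of the elimination: rows and columns with index below \<open>r\<close> are
  final, the remaining block is arbitrary. It is symmetric under transposition, so column operations
  can be done as row operations on the transpose.\<close>

definition diag_upto :: "nat \<Rightarrow> nat \<Rightarrow> nat \<Rightarrow> 'a::field mat \<Rightarrow> bool" where
  "diag_upto n m r B \<longleftrightarrow> r \<le> n \<and> r \<le> m \<and> B \<in> carrier_mat n m \<and>
     (\<forall>i<n. \<forall>j<m. i < r \<or> j < r \<longrightarrow> B $$ (i, j) = (if i = j then 1 else 0))"

lemma diag_upto_transpose: "diag_upto n m r B \<Longrightarrow> diag_upto m n r B\<^sup>T"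
  by (auto simp: diag_upto_def)

lemma diag_upto_swaprows:
  assumes "diag_upto n m r B" "r \<le> k" "k < n" "r < n"
  shows "diag_upto n m r (swaprows r k B)" and "mat_equiv n m B (swaprows r k B)"
  using assms mat_equiv_swaprows[of B n m r k] by (auto simp: diag_upto_def)

lemma diag_upto_swapcols:
  assumes "diag_upto n m r B" "r \<le> k" "k < m" "r < m"
  shows "diag_upto n m r (swaprows r k B\<^sup>T)\<^sup>T" and "mat_equiv n m B (swaprows r k B\<^sup>T)\<^sup>T"
  using diag_upto_transpose[OF diag_upto_swaprows(1)[OF diag_upto_transpose[OF assms(1)] assms(2-)]]
    mat_equiv_transpose[OF diag_upto_swaprows(2)[OF diag_upto_transpose[OF assms(1)] assms(2-)]]
  by auto

text \<open>Row \<open>r\<close> receives coefficient 0 and stays as it is. This is recorded because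
  the second use, on the transpose, must preserve the column cleared by the first.\<close>

lemma diag_upto_clear:
  fixes B :: "'a::field mat"
  assumes B: "diag_upto n m r B" and r: "r < n" "r < m" and one: "B $$ (r, r) = 1"
  obtains C where "mat_equiv n m B C" "diag_upto n m r C" "C $$ (r, r) = 1"
    "\<And>i. i < n \<Longrightarrow> i \<noteq> r \<Longrightarrow> C $$ (i, r) = 0" "\<And>j. j < m \<Longrightarrow> C $$ (r, j) = B $$ (r, j)"
proof -
  define c where "c i = (if i = r then 0 else - B $$ (i, r))" for i
  have carr: "B \<in> carrier_mat n m" using B by (simp add: diag_upto_def)
  show thesis
  proof (rule that)
    show "mat_equiv n m B (mat n m (\<lambda>(i, j). B $$ (i, j) + c i * B $$ (r, j)))"
      by (rule mat_equiv_clear_column[OF carr r(1)]) (simp add: c_def)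
    show "diag_upto n m r (mat n m (\<lambda>(i, j). B $$ (i, j) + c i * B $$ (r, j)))"
      using B r by (auto simp: diag_upto_def c_def)
  qed (use r one in \<open>auto simp: c_def\<close>)
qed

lemma diag_upto_step:
  assumes B: "diag_upto n m r B" and ij: "r \<le> i" "i < n" "r \<le> j" "j < m" "B $$ (i, j) \<noteq> 0"
  obtains C where "mat_equiv n m B C" "diag_upto n m (Suc r) C"
proof -
  have r: "r < n" "r < m" using ij by auto
  define B1 where "B1 = swaprows r i B"
  have B1: "diag_upto n m r B1" "mat_equiv n m B B1"
    unfolding B1_def using diag_upto_swaprows[OF B ij(1,2) r(1)] .
  have B1_ne: "B1 $$ (r, j) \<noteq> 0" using ij r B by (auto simp: B1_def diag_upto_def)
  define B2 where "B2 = (swaprows r j B1\<^sup>T)\<^sup>T"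
  have B2: "diag_upto n m r B2" "mat_equiv n m B1 B2"
    unfolding B2_def using diag_upto_swapcols[OF B1(1) ij(3,4) r(2)] .
  have B2_ne: "B2 $$ (r, r) \<noteq> 0" using B1_ne r ij B1(1) by (auto simp: B2_def diag_upto_def)
  define B3 where "B3 = multrow r (inverse (B2 $$ (r, r))) B2"
  have carr: "B2 \<in> carrier_mat n m" using B2 by (simp add: diag_upto_def)
  have B3: "mat_equiv n m B2 B3" unfolding B3_def
    by (rule mat_equiv_multrow[OF carr r(1)]) (use B2_ne in auto)
  have B3': "diag_upto n m r B3" "B3 $$ (r, r) = 1"
    using B2(1) r B2_ne carr by (auto simp: B3_def diag_upto_def)
  obtain B4 where B4: "mat_equiv n m B3 B4" "diag_upto n m r B4" "B4 $$ (r, r) = 1"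
    "\<And>i. i < n \<Longrightarrow> i \<noteq> r \<Longrightarrow> B4 $$ (i, r) = 0"
    using diag_upto_clear[OF B3'(1) r B3'(2)] by metis
  have carr4: "B4 \<in> carrier_mat n m" using B4 by (simp add: diag_upto_def)
  have one: "B4\<^sup>T $$ (r, r) = 1" using B4(3) carr4 r by simp
  obtain B5 where B5: "mat_equiv m n B4\<^sup>T B5" "diag_upto m n r B5" "B5 $$ (r, r) = 1"
    "\<And>i. i < m \<Longrightarrow> i \<noteq> r \<Longrightarrow> B5 $$ (i, r) = 0" "\<And>j. j < n \<Longrightarrow> B5 $$ (r, j) = B4\<^sup>T $$ (r, j)"
    using diag_upto_clear[OF diag_upto_transpose[OF B4(2)] r(2,1) one] by metis
  have B5r: "B5 $$ (r, j) = 0" if "j < n" "j \<noteq> r" for j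
    using B5(5)[OF that(1)] B4(4)[OF that] carr4 r that by simp
  have "diag_upto m n (Suc r) B5"
    using B5(2-4) B5r r by (auto simp: diag_upto_def less_Suc_eq)
  from diag_upto_transpose[OF this] have "diag_upto n m (Suc r) B5\<^sup>T" .
  moreover have "mat_equiv n m B4 B5\<^sup>T" using mat_equiv_transpose[OF B5(1)] by simp
  then have "mat_equiv n m B B5\<^sup>T"
    using B1(2) B2(2) B3 B4(1) by (blast intro: mat_equiv_trans)
  ultimately show thesis using that by blast
qed

definition diag_ones :: "nat \<Rightarrow> nat \<Rightarrow> nat \<Rightarrow> 'a::field mat" where
  "diag_ones n m r = mat n m (\<lambda>(i, j). if i = j \<and> i < r then 1 else 0)"

text \<open>At the largest \<open>r\<close> for which the invariant can be reached the remaining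
  block is zero, since a nonzero entry would be the pivot of one more step. That this
  \<open>r\<close> is the rank follows later by counting.\<close>

lemma mat_equiv_diag_ones:
  assumes A: "A \<in> carrier_mat n m"
  obtains r where "r \<le> n" "r \<le> m" "mat_equiv n m A (diag_ones n m r)"
proof -
  define P where "P r \<longleftrightarrow> (\<exists>B. mat_equiv n m A B \<and> diag_upto n m r B)" for r
  have "P 0" 
    unfolding P_def by (rule exI[of _ A]) (simp add: mat_equiv_refl A diag_upto_def)
  moreover have "\<forall>r. P r \<longrightarrow> r \<le> n" by (auto simp: P_def diag_upto_def)
  ultimately have r: "P (Greatest P)" and max: "\<And>k. P k \<Longrightarrow> k \<le> Greatest P"
    using GreatestI_nat[of P 0 n] Greatest_le_nat[of P _ n] by simp_all
  define r where "r = Greatest P"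
  obtain B where B: "mat_equiv n m A B" "diag_upto n m r B" using r unfolding P_def r_def by blast
  have zero: "B $$ (i, j) = 0" if "r \<le> i" "i < n" "r \<le> j" "j < m" for i j
  proof (rule ccontr)
    assume "B $$ (i, j) \<noteq> 0"
    with B that obtain C where "mat_equiv n m B C" "diag_upto n m (Suc r) C"
      using diag_upto_step by metis
    then have "P (Suc r)" unfolding P_def by (blast intro: mat_equiv_trans[OF B(1)])
    then show False using max[of "Suc r"] by (simp add: r_def)
  qed
  have "B = diag_ones n m r"
  proof (intro eq_matI)
    fix i j assume "i < dim_row (diag_ones n m r :: 'a mat)" "j < dim_col (diag_ones n m r :: 'a mat)"
    then have ij: "i < n" "j < m" by (auto simp: diag_ones_def)
    show "B $$ (i, j) = diag_ones n m r $$ (i, j)"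
    proof (cases "i < r \<or> j < r")
      case True
      then show ?thesis using B(2) ij by (auto simp: diag_upto_def diag_ones_def)
    next
      case False
      then show ?thesis using zero ij by (simp add: diag_ones_def)
    qed
  qed (use B in \<open>auto simp: diag_ones_def diag_upto_def\<close>)
  then show thesis using that B by (auto simp: diag_upto_def)
qed

section \<open>Counting vectors, matrices and column spaces\<close>

text \<open>Used for two counts: support below \<open>r\<close> describes the image of the normal
  form, support from \<open>r\<close> on the kernel of its transpose.\<close>

lemma card_vec_support:
  "card {v \<in> carrier_vec n. \<forall>i<n. \<not> P i \<longrightarrow> v $ i = (0 :: 'a::{field,finite})} =
    CARD('a) ^ card {i. i < n \<and> P i}"
proof -
  let ?V = "{v \<in> carrier_vec n. \<forall>i<n. \<not> P i \<longrightarrow> v $ i = (0 :: 'a)}"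
  let ?I = "{i. i < n \<and> P i}"
  have "bij_betw (\<lambda>f. vec n (\<lambda>i. if P i then f i else 0)) (?I \<rightarrow>\<^sub>E (UNIV :: 'a set)) ?V"
  proof (rule bij_betw_byWitness[where f' = "\<lambda>v. \<lambda>i\<in>?I. v $ i"])
    show "\<forall>f\<in>?I \<rightarrow>\<^sub>E UNIV. (\<lambda>i\<in>?I. vec n (\<lambda>i. if P i then f i else (0::'a)) $ i) = f"
      by (auto simp: fun_eq_iff PiE_def extensional_def)
    show "\<forall>v\<in>?V. vec n (\<lambda>i. if P i then (\<lambda>i\<in>?I. v $ i) i else 0) = v"
      by auto
    show "(\<lambda>f. vec n (\<lambda>i. if P i then f i else 0)) ` (?I \<rightarrow>\<^sub>E (UNIV :: 'a set)) \<subseteq> ?V"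
      by (rule image_subsetI) simp
    show "(\<lambda>v. \<lambda>i\<in>?I. v $ i) ` ?V \<subseteq> ?I \<rightarrow>\<^sub>E (UNIV :: 'a set)"
      by (rule image_subsetI) (simp only: restrict_PiE_iff, simp)
  qed
  then have "card (?I \<rightarrow>\<^sub>E (UNIV :: 'a set)) = card ?V" by (rule bij_betw_same_card)
  then show ?thesis by (simp add: card_PiE)
qed

lemma card_carrier_mat:
  "card (carrier_mat n m :: 'a::{field,finite} mat set) = CARD('a) ^ (n * m)"
proof -
  let ?I = "{..<n} \<times> {..<m}"
  have "bij_betw (\<lambda>f. mat n m f) (?I \<rightarrow>\<^sub>E (UNIV :: 'a set)) (carrier_mat n m)"
  proof (rule bij_betw_byWitness[where f' = "\<lambda>A. \<lambda>ij\<in>?I. A $$ ij"])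
    show "\<forall>f\<in>?I \<rightarrow>\<^sub>E UNIV. (\<lambda>ij\<in>?I. mat n m f $$ ij) = (f :: _ \<Rightarrow> 'a)"
      by (auto simp: fun_eq_iff PiE_def extensional_def)
    show "\<forall>A\<in>carrier_mat n m. mat n m (\<lambda>ij\<in>?I. A $$ ij) = A"
      by auto
  qed (auto simp: restrict_def split: if_splits)
  then have "card (?I \<rightarrow>\<^sub>E (UNIV :: 'a set)) = card (carrier_mat n m :: 'a mat set)"
    by (rule bij_betw_same_card)
  then show ?thesis by (simp add: card_PiE)
qed

lemma finite_carrier_mat: "finite (carrier_mat n m :: 'a::{field,finite} mat set)"
  by (rule card_ge_0_finite) (simp add: card_carrier_mat)

lemma finite_carrier_vec: "finite (carrier_vec n :: 'a::{field,finite} vec set)"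
  using card_vec_support[of n "\<lambda>_. True", where 'a = 'a] by (intro card_ge_0_finite) simp

text \<open>These are coordinates with respect to \<open>S\<close>, taken as extensional functions
  so that each vector of the span has exactly one.\<close>

lemma (in vec_space) card_span_lin_indpt:
  assumes S: "finite S" "S \<subseteq> carrier_vec n" "lin_indpt S"
  shows "card (span S) = CARD('a) ^ card S"
proof -
  have "bij_betw (\<lambda>a. lincomb a S) (S \<rightarrow>\<^sub>E (UNIV :: 'a set)) (span S)"
    unfolding bij_betw_def
  proof
    show "inj_on (\<lambda>a. lincomb a S) (S \<rightarrow>\<^sub>E (UNIV :: 'a set))"
    proof (rule inj_onI)
      fix a b assume ab: "a \<in> S \<rightarrow>\<^sub>E (UNIV :: 'a set)" "b \<in> S \<rightarrow>\<^sub>E (UNIV :: 'a set)"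
        and eq: "lincomb a S = lincomb b S"
      have zero: "lincomb (\<lambda>x. a x - b x) S = 0\<^sub>v n"
      proof (rule eq_vecI)
        fix i assume "i < dim_vec (0\<^sub>v n :: 'a vec)"
        then have i: "i < n" by simp
        have "lincomb (\<lambda>x. a x - b x) S $ i = lincomb a S $ i - lincomb b S $ i"
          by (simp add: lincomb_index[OF i S(2)] left_diff_distrib sum_subtractf)
        then show "lincomb (\<lambda>x. a x - b x) S $ i = 0\<^sub>v n $ i" using eq i by simp
      qed (use S in \<open>simp add: lincomb_dim\<close>)
      have "a x = b x" if "x \<in> S" for x
        using lin_dep_crit[OF S(1) subset_refl _ that _ zero] S(3) by auto
      then show "a = b" using ab by (intro PiE_ext)
    qed
    show "(\<lambda>a. lincomb a S) ` (S \<rightarrow>\<^sub>E (UNIV :: 'a set)) = span S"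
    proof
      show "(\<lambda>a. lincomb a S) ` (S \<rightarrow>\<^sub>E (UNIV :: 'a set)) \<subseteq> span S"
        using S by auto
      show "span S \<subseteq> (\<lambda>a. lincomb a S) ` (S \<rightarrow>\<^sub>E (UNIV :: 'a set))"
      proof
        fix v assume "v \<in> span S"
        then obtain a where a: "lincomb a S = v" using finite_in_span[OF S(1,2)] by auto
        have "lincomb (restrict a S) S = lincomb a S"
          by (rule lincomb_cong) (use S in auto)
        then have "lincomb (restrict a S) S = v" using a by simp
        then show "v \<in> (\<lambda>a. lincomb a S) ` (S \<rightarrow>\<^sub>E (UNIV :: 'a set))"
          by (metis PiE_restrict UNIV_I image_eqI restrict_PiE_iff)
      qed
    qed
  qed
  from bij_betw_same_card[OF this] show ?thesis using S(1) by (simp add: card_PiE)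
qed

text \<open>A maximal independent set of columns spans the column space, and its size is the rank.
  The rank thus becomes the logarithm of a cardinality, and its invariance under equivalence a
  comparison of finite images.\<close>

lemma (in vec_space) card_col_space:
  assumes A: "A \<in> carrier_mat n m"
  shows "CARD('a) ^ rank A = card ((\<lambda>x. A *\<^sub>v x) ` carrier_vec m)"
proof -
  let ?C = "set (cols A)"
  have C: "?C \<subseteq> carrier_vec n" using cols_dim[of A] A by simp
  have "lin_indpt {}" by (simp add: lin_dep_def)
  then obtain S where S: "maximal S (\<lambda>T. T \<subseteq> ?C \<and> lin_indpt T)"
    using maximal_exists_superset[of ?C "\<lambda>T. T \<subseteq> ?C \<and> lin_indpt T" "{}"] by auto
  then have SC: "S \<subseteq> ?C" "lin_indpt S" by (auto simp: maximal_def)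
  then have Sc: "S \<subseteq> carrier_vec n" "finite S" using C by (auto intro: finite_subset)
  have "?C \<subseteq> span S"
  proof
    fix v assume v: "v \<in> ?C"
    show "v \<in> span S"
    proof (rule ccontr)
      assume *: "v \<notin> span S"
      then have "v \<notin> S" using in_own_span[OF Sc(1)] by blast
      moreover have "lin_indpt (S \<union> {v})"
        using lin_dep_iff_in_span[OF Sc(1) SC(2) _ \<open>v \<notin> S\<close>] * v C by auto
      ultimately show False using S v SC(1) by (auto simp: maximal_def)
    qed
  qed
  then have "span ?C \<subseteq> span S"
    using span_is_subset span_is_submodule[OF Sc(1)] by blast
  then have "span S = span ?C" using span_is_monotone[OF SC(1)] by blast
  also have "\<dots> = (\<lambda>x. A *\<^sub>v x) ` carrier_vec m"
    using col_space_eq[OF A] A by (auto simp: col_space_def)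
  finally show ?thesis
    using rank_card_indpt[OF A S] card_span_lin_indpt[OF Sc(2,1) SC(2)] by simp
qed

text \<open>The image of \<open>A\<close> lies in \<open>U\<close> applied to the image of
  \<open>B\<close>. One inequality suffices because the equivalence is symmetric.\<close>

lemma card_col_space_mat_equiv_le:
  fixes A :: "'a::{field,finite} mat"
  assumes "mat_equiv n m A B"
  shows "card ((\<lambda>x. A *\<^sub>v x) ` carrier_vec m) \<le> card ((\<lambda>x. B *\<^sub>v x) ` carrier_vec m)"
proof -
  obtain U V where *: "B \<in> carrier_mat n m" "U \<in> carrier_mat n n" "V \<in> carrier_mat m m"
    "A = U * B * V"
    using assms unfolding mat_equiv_def by blast
  have "(\<lambda>x. A *\<^sub>v x) ` carrier_vec m \<subseteq> (\<lambda>y. U *\<^sub>v y) ` (\<lambda>x. B *\<^sub>v x) ` carrier_vec m"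
  proof
    fix y assume "y \<in> (\<lambda>x. A *\<^sub>v x) ` carrier_vec m"
    then obtain x where x: "x \<in> carrier_vec m" "y = A *\<^sub>v x" by auto
    have "y = U *\<^sub>v (B *\<^sub>v (V *\<^sub>v x))"
      using x * by (simp add: assoc_mult_mat_vec[of _ n m _ m] assoc_mult_mat_vec[of _ n n _ m])
    moreover have "V *\<^sub>v x \<in> carrier_vec m" using x * by simp
    ultimately show "y \<in> (\<lambda>y. U *\<^sub>v y) ` (\<lambda>x. B *\<^sub>v x) ` carrier_vec m" by blast
  qed
  then show ?thesis
    by (meson card_image_le card_mono finite_carrier_vec finite_imageI le_trans)
qed

lemma diag_ones_carrier [simp]: "diag_ones n m r \<in> carrier_mat n m"
  by (simp add: diag_ones_def)

lemma diag_ones_mult_vec: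
  assumes "x \<in> carrier_vec m" "r \<le> m"
  shows "diag_ones n m r *\<^sub>v x = vec n (\<lambda>i. if i < r then x $ i else 0)"
proof (rule eq_vecI)
  fix i assume "i < dim_vec (vec n (\<lambda>i. if i < r then x $ i else 0))"
  then have i: "i < n" by simp
  have "(diag_ones n m r *\<^sub>v x) $ i = (\<Sum>j\<in>{0..<m}. (if i = j \<and> i < r then 1 else 0) * x $ j)"
    using i assms by (simp add: diag_ones_def scalar_prod_def)
  also have "\<dots> = (\<Sum>j\<in>{0..<m}. if j = i then (if i < r then x $ j else 0) else 0)"
    by (rule sum.cong) auto
  finally show "(diag_ones n m r *\<^sub>v x) $ i = vec n (\<lambda>i. if i < r then x $ i else 0) $ i"
    using i assms by auto
qed (simp add: diag_ones_def)

lemma card_col_space_diag_ones: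
  assumes "r \<le> n" "r \<le> m"
  shows "card ((\<lambda>x. (diag_ones n m r :: 'a::{field,finite} mat) *\<^sub>v x) ` carrier_vec m) = CARD('a) ^ r"
proof -
  let ?V = "{v \<in> carrier_vec n. \<forall>i<n. \<not> i < r \<longrightarrow> v $ i = (0::'a)}"
  have "(\<lambda>x. (diag_ones n m r :: 'a mat) *\<^sub>v x) ` carrier_vec m = ?V"
  proof
    show "(\<lambda>x. diag_ones n m r *\<^sub>v x) ` carrier_vec m \<subseteq> ?V"
      using assms by (auto simp: diag_ones_mult_vec)
    show "?V \<subseteq> (\<lambda>x. diag_ones n m r *\<^sub>v x) ` carrier_vec m"
    proof
      fix v assume v: "v \<in> ?V"
      have "v = diag_ones n m r *\<^sub>v vec m (\<lambda>i. if i < r then v $ i else 0)"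
        using v assms by (subst diag_ones_mult_vec) (auto simp: not_less)
      then show "v \<in> (\<lambda>x. diag_ones n m r *\<^sub>v x) ` carrier_vec m" by auto
    qed
  qed
  moreover have "{i. i < n \<and> i < r} = {..<r}" using assms by auto
  ultimately show ?thesis by (simp add: card_vec_support)
qed

lemma rank_mat_equiv_diag_ones:
  fixes A :: "'a::{field,finite} mat"
  assumes A: "A \<in> carrier_mat n m"
  shows "mat_equiv n m A (diag_ones n m (vec_space.rank n A))"
    and "vec_space.rank n A \<le> n" and "vec_space.rank n A \<le> m"
proof -
  obtain r where r: "r \<le> n" "r \<le> m" and eq: "mat_equiv n m A (diag_ones n m r)"
    using mat_equiv_diag_ones[OF A] .
  have "CARD('a) ^ vec_space.rank n A = card ((\<lambda>x. A *\<^sub>v x) ` carrier_vec m)"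
    by (rule vec_space.card_col_space[OF A])
  also have "\<dots> = CARD('a) ^ r"
    unfolding card_col_space_diag_ones[OF r, symmetric]
    using card_col_space_mat_equiv_le[OF eq] card_col_space_mat_equiv_le[OF mat_equiv_sym[OF eq]]
    by (rule antisym)
  finally have "CARD('a) ^ vec_space.rank n A = CARD('a) ^ r" .
  moreover have "card {0, 1 :: 'a} \<le> CARD('a)" by (rule card_mono) auto
  then have "CARD('a) > 1" by simp
  ultimately have "vec_space.rank n A = r" by (metis power_inject_exp)
  with r eq show "mat_equiv n m A (diag_ones n m (vec_space.rank n A))"
    "vec_space.rank n A \<le> n" "vec_space.rank n A \<le> m" by simp_all
qed

section \<open>Isomorphisms of sandwich semigroups\<close>

text \<open>Closure of the source allows the inverse to be evaluated at the image of a product. For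
  this reason closure of the regular part is established below.\<close>

lemma semigrp_iso_sym:
  assumes "semigrp S" and "S \<cong>\<^sub>s T"
  shows "T \<cong>\<^sub>s S"
proof -
  obtain h where h: "bij_betw h (carrier S) (carrier T)"
    and hom: "\<And>x y. x \<in> carrier S \<Longrightarrow> y \<in> carrier S \<Longrightarrow> h (op S x y) = op T (h x) (h y)"
    using assms(2) unfolding semigrp_iso_def by blast
  let ?g = "the_inv_into (carrier S) h"
  have inj: "inj_on h (carrier S)" and surj: "h ` carrier S = carrier T"
    using h by (auto simp: bij_betw_def)
  have "?g (op T x y) = op S (?g x) (?g y)" if xy: "x \<in> carrier T" "y \<in> carrier T" for x y
  proof -
    obtain a b where ab: "a \<in> carrier S" "b \<in> carrier S" "x = h a" "y = h b"
      using xy surj by blast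
    have "op T x y = h (op S a b)" using ab hom by simp
    moreover have "op S a b \<in> carrier S" using semigrp.op_closed[OF assms(1)] ab by blast
    ultimately show ?thesis using ab by (simp add: the_inv_into_f_f[OF inj])
  qed
  then show ?thesis
    unfolding semigrp_iso_def using bij_betw_the_inv_into[OF h] by blast
qed

lemma semigrp_iso_trans:
  assumes "S \<cong>\<^sub>s T" and "T \<cong>\<^sub>s U"
  shows "S \<cong>\<^sub>s U"
proof -
  obtain h where h: "bij_betw h (carrier S) (carrier T)"
    and hom: "\<And>x y. x \<in> carrier S \<Longrightarrow> y \<in> carrier S \<Longrightarrow> h (op S x y) = op T (h x) (h y)"
    using assms(1) unfolding semigrp_iso_def by blast
  obtain g where g: "bij_betw g (carrier T) (carrier U)"
    and hom': "\<And>x y. x \<in> carrier T \<Longrightarrow> y \<in> carrier T \<Longrightarrow> g (op T x y) = op U (g x) (g y)"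
    using assms(2) unfolding semigrp_iso_def by blast
  have "h x \<in> carrier T" if "x \<in> carrier S" for x
    using h that by (auto simp: bij_betw_def)
  then have "\<forall>x\<in>carrier S. \<forall>y\<in>carrier S. (g \<circ> h) (op S x y) = op U ((g \<circ> h) x) ((g \<circ> h) y)"
    using hom hom' by simp
  then show ?thesis
    unfolding semigrp_iso_def using bij_betw_trans[OF h g] by blast
qed

lemma carrier_Reg:
  "x \<in> carrier (Reg S) \<longleftrightarrow> x \<in> carrier S \<and> (\<exists>y\<in>carrier S. x = op S (op S x y) x)"
  by (simp add: Reg_def)

lemma op_Reg [simp]: "op (Reg S) = op S"
  by (simp add: Reg_def)

text \<open>Regularity is an equation between products, so \<open>h\<close> preserves it and, being
  injective, also reflects it.\<close>

lemma semigrp_iso_Reg: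
  assumes S: "semigrp S" and "S \<cong>\<^sub>s T"
  shows "Reg S \<cong>\<^sub>s Reg T"
proof -
  obtain h where h: "bij_betw h (carrier S) (carrier T)"
    and hom: "\<And>x y. x \<in> carrier S \<Longrightarrow> y \<in> carrier S \<Longrightarrow> h (op S x y) = op T (h x) (h y)"
    using assms(2) unfolding semigrp_iso_def by blast
  have inj: "inj_on h (carrier S)" and surj: "carrier T = h ` carrier S"
    using h by (auto simp: bij_betw_def)
  have closed: "op S x y \<in> carrier S" if "x \<in> carrier S" "y \<in> carrier S" for x y
    using semigrp.op_closed[OF S] that by blast
  have iff: "h x = op T (op T (h x) (h y)) (h x) \<longleftrightarrow> x = op S (op S x y) x"
    if "x \<in> carrier S" "y \<in> carrier S" for x y
    using inj_on_eq_iff[OF inj, of x "op S (op S x y) x"] that closed by (simp add: hom)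
  have sub: "carrier (Reg S) \<subseteq> carrier S" by (auto simp: carrier_Reg)
  have "h ` carrier (Reg S) = carrier (Reg T)"
  proof
    show "h ` carrier (Reg S) \<subseteq> carrier (Reg T)"
      using iff by (fastforce simp: carrier_Reg surj)
    show "carrier (Reg T) \<subseteq> h ` carrier (Reg S)"
    proof
      fix t assume "t \<in> carrier (Reg T)"
      then obtain x y where "x \<in> carrier S" "y \<in> carrier S" "t = h x" "h x = op T (op T (h x) (h y)) (h x)"
        by (auto simp: carrier_Reg surj)
      moreover from this iff have "x \<in> carrier (Reg S)" unfolding carrier_Reg by blast
      ultimately show "t \<in> h ` carrier (Reg S)" by blast
    qed
  qed
  then have "bij_betw h (carrier (Reg S)) (carrier (Reg T))"
    using inj_on_subset[OF inj sub] by (simp add: bij_betw_def)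
  then show ?thesis
    unfolding semigrp_iso_def using hom sub by (auto simp: subset_iff)
qed

lemma carrier_sandwich [simp]: "carrier (sandwich m n A) = carrier_mat m n"
  by (simp add: sandwich_def)

lemma op_sandwich [simp]: "op (sandwich m n A) X Y = X * A * Y"
  by (simp add: sandwich_def)

lemma mult_mat_assoc_dim:
  fixes A B C :: "'a::semiring_0 mat"
  assumes "dim_col A = dim_row B" "dim_col B = dim_row C"
  shows "A * B * C = A * (B * C)"
  using assms by (intro assoc_mult_mat[of A "dim_row A" "dim_row B" B "dim_col B" C "dim_col C"]) auto

text \<open>For A = U B V the isomorphism is X \<mapsto> V X U, because V (X A Y) U regroups as (V X
  U) B (V Y U).\<close>

lemma sandwich_iso_mat_equiv:
  fixes A :: "'a::field mat"
  assumes "mat_equiv n m A B"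
  shows "sandwich m n A \<cong>\<^sub>s sandwich m n B"
proof -
  obtain U U' V V' where *: "A \<in> carrier_mat n m" "B \<in> carrier_mat n m" "U \<in> carrier_mat n n"
    "U' \<in> carrier_mat n n" "V \<in> carrier_mat m m" "V' \<in> carrier_mat m m" and inv: "U * U' = 1\<^sub>m n"
    "U' * U = 1\<^sub>m n" "V * V' = 1\<^sub>m m" "V' * V = 1\<^sub>m m" and A: "A = U * B * V"
    using assms unfolding mat_equiv_def by blast
  have cancel: "P * (P' * X * Q') * Q = X"
    if "X \<in> carrier_mat m n" "P \<in> carrier_mat m m" "P' \<in> carrier_mat m m" "Q \<in> carrier_mat n n"
      "Q' \<in> carrier_mat n n" "P * P' = 1\<^sub>m m" "Q' * Q = 1\<^sub>m n" for X P P' Q Q' :: "'a mat"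
  proof -
    have "P * (P' * X * Q') * Q = (P * P') * X * (Q' * Q)"
      using that(1-5) by (simp add: mult_mat_assoc_dim)
    then show ?thesis using that by simp
  qed
  have "bij_betw (\<lambda>X. V * X * U) (carrier_mat m n) (carrier_mat m n)"
  proof (rule bij_betw_byWitness[where f' = "\<lambda>X. V' * X * U'"])
    show "\<forall>X\<in>carrier_mat m n. V' * (V * X * U) * U' = X"
      "\<forall>X\<in>carrier_mat m n. V * (V' * X * U') * U = X"
      by (intro ballI cancel; use * inv in simp)+
  qed (use * in auto)
  moreover have "V * (X * A * Y) * U = (V * X * U) * B * (V * Y * U)"
    if "X \<in> carrier_mat m n" "Y \<in> carrier_mat m n" for X Y
    unfolding A using that *(2-) by (simp add: mult_mat_assoc_dim)
  ultimately show ?thesis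
    unfolding semigrp_iso_def carrier_sandwich op_sandwich by blast
qed

section \<open>Regularity of matrices and closure of the regular part\<close>

lemma diag_ones_mult:
  assumes "r \<le> m"
  shows "diag_ones n m r * diag_ones m k r = (diag_ones n k r :: 'a::field mat)"
proof (rule eq_matI)
  fix i j assume "i < dim_row (diag_ones n k r :: 'a mat)" "j < dim_col (diag_ones n k r :: 'a mat)"
  then have ij: "i < n" "j < k" by (auto simp: diag_ones_def)
  have "(diag_ones n m r * diag_ones m k r :: 'a mat) $$ (i, j) =
      (\<Sum>x\<in>{0..<m}. (if i = x \<and> i < r then 1 else 0) * (if x = j \<and> x < r then 1 else 0))"
    using ij by (simp add: diag_ones_def scalar_prod_def)
  also have "\<dots> = (\<Sum>x\<in>{0..<m}. if x = i then (if i = j \<and> i < r then 1 else 0) else 0)"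
    by (rule sum.cong) auto
  also have "\<dots> = (if i = j \<and> i < r then 1 else 0)" using assms by auto
  finally show "(diag_ones n m r * diag_ones m k r :: 'a mat) $$ (i, j) = diag_ones n k r $$ (i, j)"
    using ij by (simp add: diag_ones_def)
qed (auto simp: diag_ones_def)

text \<open>For W = U J V take G = V' K U', with V' and U' the inverses and K the transposed normal
  form; the claim reduces to J K J = J.\<close>

lemma mat_von_Neumann_regular:
  fixes W :: "'a::field mat"
  assumes W: "W \<in> carrier_mat n m"
  obtains G where "G \<in> carrier_mat m n" "W * G * W = W"
proof -
  obtain r where r: "r \<le> n" "r \<le> m" and eq: "mat_equiv n m W (diag_ones n m r)"
    using mat_equiv_diag_ones[OF W] .
  let ?J = "diag_ones n m r :: 'a mat" and ?K = "diag_ones m n r :: 'a mat"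
  obtain U U' V V' where *: "U \<in> carrier_mat n n" "U' \<in> carrier_mat n n" "V \<in> carrier_mat m m"
    "V' \<in> carrier_mat m m" and inv: "U' * U = 1\<^sub>m n" "V * V' = 1\<^sub>m m" and W: "W = U * ?J * V"
    using eq unfolding mat_equiv_def by blast
  have dims: "dim_row ?J = n" "dim_col ?J = m" "dim_row ?K = m" "dim_col ?K = n"
    by (simp_all add: diag_ones_def)
  have "W * (V' * ?K * U') * W = U * (?J * (V * V') * ?K * (U' * U) * ?J) * V"
    unfolding W using * by (simp add: mult_mat_assoc_dim dims)
  also have "?J * (V * V') * ?K * (U' * U) * ?J = ?J * ?K * ?J"
    unfolding inv by (simp add: right_mult_one_mat[of _ n m] right_mult_one_mat[of _ n n]
        mult_carrier_mat[of _ n m])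
  also have "?J * ?K * ?J = ?J" using r by (simp add: diag_ones_mult)
  finally have "W * (V' * ?K * U') * W = W" unfolding W .
  moreover have "V' * ?K * U' \<in> carrier_mat m n" using * by auto
  ultimately show thesis using that by blast
qed

lemma carrier_Reg_sandwich:
  "X \<in> carrier (Reg (sandwich m n A)) \<longleftrightarrow>
    X \<in> carrier_mat m n \<and> (\<exists>Y\<in>carrier_mat m n. X = X * A * Y * A * X)"
  by (simp add: carrier_Reg)

text \<open>Regular elements of an arbitrary semigroup need not be closed under products. Here an
  inner inverse \<open>G\<close> of the matrix W = A X A X' A serves as inverse of the product X A
  X'.\<close>

lemma semigrp_Reg_sandwich:
  fixes A :: "'a::field mat"
  assumes A: "A \<in> carrier_mat n m"
  shows "semigrp (Reg (sandwich m n A))"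
proof
  fix X X' assume "X \<in> carrier (Reg (sandwich m n A))" "X' \<in> carrier (Reg (sandwich m n A))"
  then obtain Y Y' where X: "X \<in> carrier_mat m n" "Y \<in> carrier_mat m n" "X = X * A * Y * A * X"
    and X': "X' \<in> carrier_mat m n" "Y' \<in> carrier_mat m n" "X' = X' * A * Y' * A * X'"
    by (auto simp: carrier_Reg_sandwich)
  note carr = A X(1,2) X'(1,2)
  \<comment> \<open>This \<open>W\<close> is what appears between X A Y and Y' A X' when both
    factors of X A X' are expanded by regularity; replacing it by W G W then folds back to the
    product on both sides of A G A.\<close>
  define W where "W = A * X * A * X' * A"
  have W: "W \<in> carrier_mat n m" unfolding W_def using carr by (intro carrier_matI) simp_all
  then obtain G where G: "G \<in> carrier_mat m n" "W * G * W = W"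
    using mat_von_Neumann_regular by blast
  have "X * A * X' = (X * A * Y * A * X) * A * (X' * A * Y' * A * X')"
    using X(3) X'(3) by simp
  also have "\<dots> = X * A * Y * W * Y' * A * X'"
    unfolding W_def using carr by (simp add: mult_mat_assoc_dim)
  also have "\<dots> = X * A * Y * (W * G * W) * Y' * A * X'"
    by (simp only: G(2))
  also have "\<dots> = (X * A * Y * A * X) * A * X' * A * G * A * X * A * (X' * A * Y' * A * X')"
    unfolding W_def using carr G(1) by (simp add: mult_mat_assoc_dim)
  also have "\<dots> = (X * A * X') * A * G * A * (X * A * X')"
    unfolding X(3)[symmetric] X'(3)[symmetric] using carr G(1) by (simp add: mult_mat_assoc_dim)
  finally show "op (Reg (sandwich m n A)) X X' \<in> carrier (Reg (sandwich m n A))"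
    using carr G(1) by (auto simp: carrier_Reg_sandwich)
next
  fix X Y Z
  assume "X \<in> carrier (Reg (sandwich m n A))" "Y \<in> carrier (Reg (sandwich m n A))"
    "Z \<in> carrier (Reg (sandwich m n A))"
  then have "X \<in> carrier_mat m n" "Y \<in> carrier_mat m n" "Z \<in> carrier_mat m n"
    unfolding carrier_Reg_sandwich by blast+
  then show "op (Reg (sandwich m n A)) (op (Reg (sandwich m n A)) X Y) Z =
      op (Reg (sandwich m n A)) X (op (Reg (sandwich m n A)) Y Z)"
    using A by (simp add: mult_mat_assoc_dim)
qed

lemma sandwich_iso_map_mat:
  fixes \<phi> :: "'a::field \<Rightarrow> 'b::field"
  assumes bij: "bij \<phi>" and add: "\<And>x y. \<phi> (x + y) = \<phi> x + \<phi> y"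
    and mult: "\<And>x y. \<phi> (x * y) = \<phi> x * \<phi> y" and A: "A \<in> carrier_mat n m"
  shows "sandwich m n A \<cong>\<^sub>s sandwich m n (map_mat \<phi> A)"
proof -
  have zero: "\<phi> 0 = 0" by (metis add add.right_neutral add_left_cancel)
  have sum: "\<phi> (sum f I) = (\<Sum>i\<in>I. \<phi> (f i))" if "finite I" for f and I :: "nat set"
    using that by induction (simp_all add: zero add)
  have map_mult: "map_mat \<phi> (X * Y) = map_mat \<phi> X * map_mat \<phi> Y"
    if "X \<in> carrier_mat i j" "Y \<in> carrier_mat j k" for X Y i j k
    by (rule eq_matI) (use that in \<open>auto simp: scalar_prod_def sum mult\<close>)
  have "bij_betw (map_mat \<phi>) (carrier_mat m n) (carrier_mat m n)"
    by (rule bij_betw_byWitness[where f' = "map_mat (inv_into UNIV \<phi>)"])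
      (use bij in \<open>auto simp: bij_def surj_f_inv_f\<close>)
  moreover have "map_mat \<phi> (X * A * Y) = map_mat \<phi> X * map_mat \<phi> A * map_mat \<phi> Y"
    if "X \<in> carrier_mat m n" "Y \<in> carrier_mat m n" for X Y
    using that A map_mult[of "X * A" m m Y n] map_mult[of X m n A m] by simp
  ultimately show ?thesis
    unfolding semigrp_iso_def carrier_sandwich op_sandwich by blast
qed

text \<open>The two matrices are joined through the normal form: its entries are 0 and 1, so a field
  isomorphism carries it to the normal form of the same rank over the other field.\<close>

lemma sandwich_iso_of_card_eq:
  fixes A :: "'a::{field,finite} mat" and B :: "'b::{field,finite} mat"
  assumes card: "CARD('a) = CARD('b)" and A: "A \<in> carrier_mat n m" and B: "B \<in> carrier_mat n m"
    and rank: "vec_space.rank n A = vec_space.rank n B"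
  shows "sandwich m n A \<cong>\<^sub>s sandwich m n B"
proof -
  obtain \<phi> :: "'a \<Rightarrow> 'b" where \<phi>: "bij \<phi>" "\<And>x y. \<phi> (x + y) = \<phi> x + \<phi> y"
    "\<And>x y. \<phi> (x * y) = \<phi> x * \<phi> y"
    using finite_field_iso[OF card] by blast
  let ?r = "vec_space.rank n B"
  have zero: "\<phi> 0 = 0" by (metis \<phi>(2) add.right_neutral add_left_cancel)
  have one: "\<phi> 1 = 1"
    by (metis \<phi>(1,3) zero bij_is_inj injD mult_cancel_right2 mult_1 one_neq_zero)
  have "map_mat \<phi> (diag_ones n m ?r) = diag_ones n m ?r"
    by (rule eq_matI) (auto simp: diag_ones_def zero one)
  then have "sandwich m n (diag_ones n m ?r :: 'a mat) \<cong>\<^sub>s sandwich m n (diag_ones n m ?r :: 'b mat)"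
    using sandwich_iso_map_mat[OF \<phi> diag_ones_carrier[of n m ?r]] by simp
  moreover have "sandwich m n A \<cong>\<^sub>s sandwich m n (diag_ones n m ?r :: 'a mat)"
    using sandwich_iso_mat_equiv[OF rank_mat_equiv_diag_ones(1)[OF A]] rank by simp
  moreover have "sandwich m n (diag_ones n m ?r :: 'b mat) \<cong>\<^sub>s sandwich m n B"
    by (rule sandwich_iso_mat_equiv[OF mat_equiv_sym[OF rank_mat_equiv_diag_ones(1)[OF B]]])
  ultimately show ?thesis by (blast intro: semigrp_iso_trans)
qed

lemma rank_0_iff:
  fixes A :: "'a::{field,finite} mat"
  assumes A: "A \<in> carrier_mat n m"
  shows "vec_space.rank n A = 0 \<longleftrightarrow> A = 0\<^sub>m n m"
proof
  assume "vec_space.rank n A = 0"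
  then have "mat_equiv n m A (diag_ones n m 0)"
    using rank_mat_equiv_diag_ones(1)[OF A] by simp
  moreover have "diag_ones n m 0 = (0\<^sub>m n m :: 'a mat)"
    by (rule eq_matI) (auto simp: diag_ones_def)
  ultimately show "A = 0\<^sub>m n m" by (auto simp: mat_equiv_def)
next
  assume "A = 0\<^sub>m n m"
  then show "vec_space.rank n A = 0" by (simp add: vec_space.rank_0I)
qed

section \<open>Ideals generated by idempotents\<close>

lemma assoc_mult_mat_vec_dim:
  fixes A B :: "'a::semiring_0 mat"
  assumes "dim_col A = dim_row B" "dim_col B = dim_vec v"
  shows "A * B *\<^sub>v v = A *\<^sub>v (B *\<^sub>v v)"
  using assms by (intro assoc_mult_mat_vec[of A "dim_row A" "dim_row B" B "dim_col B"]) auto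

lemma transpose_mult_dim:
  fixes A B :: "'a::comm_semiring_0 mat"
  assumes "dim_col A = dim_row B"
  shows "(A * B)\<^sup>T = B\<^sup>T * A\<^sup>T"
  using assms by (intro transpose_mult[of A "dim_row A" "dim_row B" B "dim_col B"]) auto

lemma smult_mult_dim:
  fixes A B :: "'a::comm_semiring_0 mat"
  assumes "dim_col A = dim_row B"
  shows "(c \<cdot>\<^sub>m A) * B = c \<cdot>\<^sub>m (A * B)" and "A * (c \<cdot>\<^sub>m B) = c \<cdot>\<^sub>m (A * B)"
  using assms by (intro mult_smult_assoc_mat[of A "dim_row A" "dim_row B" B "dim_col B"]
      mult_smult_distrib[of A "dim_row A" "dim_row B" B "dim_col B"]; auto)+

lemma one_smult_mat: "(1 :: 'a::semiring_1) \<cdot>\<^sub>m A = A"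
  by (rule eq_matI) auto

section \<open>Outer products and regular elements\<close>

definition outer :: "'a::field vec \<Rightarrow> 'a vec \<Rightarrow> 'a mat" where
  "outer u w = mat (dim_vec u) (dim_vec w) (\<lambda>(i, j). u $ i * w $ j)"

lemma outer_carrier [simp]: "u \<in> carrier_vec m \<Longrightarrow> w \<in> carrier_vec n \<Longrightarrow> outer u w \<in> carrier_mat m n"
  by (simp add: outer_def)

lemma mult_outer:
  assumes "M \<in> carrier_mat k m" "u \<in> carrier_vec m"
  shows "M * outer u w = outer (M *\<^sub>v u) w"
  by (rule eq_matI) (use assms in \<open>auto simp: outer_def scalar_prod_def sum_distrib_right mult.assoc\<close>)

lemma outer_mult:
  assumes "M \<in> carrier_mat n k" "w \<in> carrier_vec n"
  shows "outer u w * M = outer u (M\<^sup>T *\<^sub>v w)"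
  by (rule eq_matI) (use assms in \<open>auto simp: outer_def scalar_prod_def sum_distrib_left mult.assoc mult.commute mult.left_commute\<close>)

lemma outer_mult_outer:
  assumes "w \<in> carrier_vec n" "u' \<in> carrier_vec n"
  shows "outer u w * outer u' w' = (w \<bullet> u') \<cdot>\<^sub>m outer u w'"
  by (rule eq_matI) (use assms in \<open>auto simp: outer_def scalar_prod_def sum_distrib_left sum_distrib_right mult.assoc mult.commute mult.left_commute\<close>)

lemma transpose_outer: "(outer u w)\<^sup>T = outer w u"
  by (rule eq_matI) (auto simp: outer_def)

lemma outer_zero: "u \<in> carrier_vec m \<Longrightarrow> outer u (0\<^sub>v n) = 0\<^sub>m m n"
  by (rule eq_matI) (auto simp: outer_def)

lemma vec_nonzero_index:
  assumes "v \<in> carrier_vec n" "v \<noteq> 0\<^sub>v n"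
  obtains i where "i < n" "v $ i \<noteq> 0"
  using assms by (metis carrier_vecD eq_vecI index_zero_vec)

lemma vec_nonzero_scalar_prod:
  fixes v :: "'a::field vec"
  assumes v: "v \<in> carrier_vec n" "v \<noteq> 0\<^sub>v n"
  obtains p where "p \<in> carrier_vec n" "v \<bullet> p = 1" "p \<bullet> v = 1"
proof -
  obtain i where i: "i < n" "v $ i \<noteq> 0" using vec_nonzero_index[OF v] .
  let ?p = "inverse (v $ i) \<cdot>\<^sub>v unit_vec n i"
  have "v \<bullet> ?p = 1" using v i by (simp add: scalar_prod_smult_right)
  moreover have "?p \<in> carrier_vec n" by simp
  ultimately show thesis using that[of ?p] v comm_scalar_prod[of v n ?p] by simp
qed

lemma inj_outer:
  assumes u: "u \<in> carrier_vec m" "u \<noteq> 0\<^sub>v m"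
  shows "inj_on (outer u) (carrier_vec n)"
proof (rule inj_onI)
  fix v w :: "'a vec" assume v: "v \<in> carrier_vec n" "w \<in> carrier_vec n" and eq: "outer u v = outer u w"
  obtain i where i: "i < m" "u $ i \<noteq> 0" using vec_nonzero_index[OF u] .
  show "v = w"
  proof (rule eq_vecI)
    fix j assume "j < dim_vec w"
    then have j: "j < n" using v by simp
    have "outer u v $$ (i, j) = outer u w $$ (i, j)" using eq by simp
    then show "v $ j = w $ j" using i j u v by (simp add: outer_def)
  qed (use v in simp)
qed

lemma outer_nonzero:
  assumes "u \<in> carrier_vec m" "u \<noteq> 0\<^sub>v m" "w \<in> carrier_vec n" "w \<noteq> 0\<^sub>v n"
  shows "outer u w \<noteq> 0\<^sub>m m n"
  using inj_onD[OF inj_outer[OF assms(1,2)], of w "0\<^sub>v n" n] assms by (auto simp: outer_zero)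

abbreviation reg_carrier :: "nat \<Rightarrow> nat \<Rightarrow> 'a::field mat \<Rightarrow> 'a mat set" where
  "reg_carrier m n A \<equiv> carrier (Reg (sandwich m n A))"

text \<open>If A u \<noteq> 0, these are the \<open>w\<close> for which the matrix u w^T is regular.
  The zero vector is included because the zero matrix is regular.\<close>

definition reg_vecs :: "nat \<Rightarrow> nat \<Rightarrow> 'a::field mat \<Rightarrow> 'a vec set" where
  "reg_vecs n m A = {w \<in> carrier_vec n. A\<^sup>T *\<^sub>v w \<noteq> 0\<^sub>v m \<or> w = 0\<^sub>v n}"

lemma reg_carrier_subset: "reg_carrier m n A \<subseteq> carrier_mat m n"
  by (auto simp: carrier_Reg_sandwich)

lemma finite_reg_carrier: "finite (reg_carrier m n (A :: 'a::{field,finite} mat))"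
  using finite_subset[OF reg_carrier_subset finite_carrier_mat] .

lemma zero_in_reg_carrier:
  assumes "A \<in> carrier_mat n m"
  shows "0\<^sub>m m n \<in> reg_carrier m n A"
  unfolding carrier_Reg_sandwich using assms
  by (intro conjI bexI[of _ "0\<^sub>m m n"]) simp_all

text \<open>For c \<noteq> 0 the multiple of \<open>e\<close> by the inverse of \<open>c\<close> is
  an inverse of the multiple by \<open>c\<close>. These multiples supply the \<open>q\<close>
  elements needed in the lower bound for eRe.\<close>

lemma smult_in_reg_carrier:
  fixes A :: "'a::field mat"
  assumes A: "A \<in> carrier_mat n m" and e: "e \<in> carrier_mat m n" "e * A * e = e"
  shows "c \<cdot>\<^sub>m e \<in> reg_carrier m n A"
proof (cases "c = 0")
  case True
  then have "c \<cdot>\<^sub>m e = 0\<^sub>m m n" using e by (intro eq_matI) auto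
  then show ?thesis using zero_in_reg_carrier[OF A] by simp
next
  case False
  have scale: "(a \<cdot>\<^sub>m e) * A * (b \<cdot>\<^sub>m e) = (a * b) \<cdot>\<^sub>m e" for a b
  proof -
    have "(a \<cdot>\<^sub>m e) * A * (b \<cdot>\<^sub>m e) = b \<cdot>\<^sub>m (a \<cdot>\<^sub>m (e * A * e))"
      using A e(1) by (simp add: smult_mult_dim mult_mat_assoc_dim)
    also have "\<dots> = (a * b) \<cdot>\<^sub>m e" unfolding e(2) by (rule eq_matI) auto
    finally show ?thesis .
  qed
  have "(c \<cdot>\<^sub>m e) * A * (inverse c \<cdot>\<^sub>m e) * A * (c \<cdot>\<^sub>m e) = c \<cdot>\<^sub>m e"
    unfolding scale using False by (simp add: scale)
  then show ?thesis
    unfolding carrier_Reg_sandwich using e(1) by (metis smult_carrier_mat)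
qed

text \<open>Choose \<open>p\<close> with w^T A p = 1 and \<open>t\<close> with t^T A u = 1. Then p
  t^T is an inverse of u w^T, both scalars in the middle being 1.\<close>

lemma outer_in_reg_carrier:
  fixes A :: "'a::field mat"
  assumes A: "A \<in> carrier_mat n m" and u: "u \<in> carrier_vec m" "A *\<^sub>v u \<noteq> 0\<^sub>v n"
    and w: "w \<in> carrier_vec n" "A\<^sup>T *\<^sub>v w \<noteq> 0\<^sub>v m"
  shows "outer u w \<in> reg_carrier m n A"
proof -
  have Aw: "A\<^sup>T *\<^sub>v w \<in> carrier_vec m" and Au: "A *\<^sub>v u \<in> carrier_vec n" using A u w by auto
  obtain p where p: "p \<in> carrier_vec m" "(A\<^sup>T *\<^sub>v w) \<bullet> p = 1"
    using vec_nonzero_scalar_prod[OF Aw w(2)] by blast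
  obtain t where t: "t \<in> carrier_vec n" "t \<bullet> (A *\<^sub>v u) = 1"
    using vec_nonzero_scalar_prod[OF Au u(2)] by blast
  have "outer u w * A * outer p t = outer u t"
    using A u w p t Aw by (simp add: outer_mult outer_mult_outer[OF Aw] one_smult_mat)
  then have "outer u w * A * outer p t * A * outer u w = outer u t * (A * outer u w)"
    using A u w t by (simp add: mult_mat_assoc_dim outer_def)
  also have "\<dots> = outer u w"
    using t by (simp add: mult_outer[OF A u(1)] outer_mult_outer[OF t(1) Au] one_smult_mat)
  finally show ?thesis
    unfolding carrier_Reg_sandwich using u w p t by (metis outer_carrier)
qed

lemma outer_reg_vecs_in_reg_carrier:
  fixes A :: "'a::field mat"
  assumes A: "A \<in> carrier_mat n m" and u: "u \<in> carrier_vec m" "A *\<^sub>v u \<noteq> 0\<^sub>v n"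
    and w: "w \<in> reg_vecs n m A"
  shows "outer u w \<in> reg_carrier m n A"
  using w outer_in_reg_carrier[OF A u] zero_in_reg_carrier[OF A] outer_zero[OF u(1), of n]
  unfolding reg_vecs_def by auto

text \<open>The lower bounds on the sizes of eR and eRe hold for every nonzero idempotent e; the upper
  bounds below are attained at a rank one idempotent, so these sizes have computable minima.\<close>

lemma reg_vecs_le_card_right_ideal:
  fixes A :: "'a::{field,finite} mat"
  assumes A: "A \<in> carrier_mat n m" and e: "e \<in> carrier_mat m n" "e * A * e = e" "e \<noteq> 0\<^sub>m m n"
  shows "card (reg_vecs n m A) \<le> card ((\<lambda>X. e * A * X) ` reg_carrier m n A)"
proof -
  obtain i j where ij: "i < m" "j < n" "e $$ (i, j) \<noteq> 0"
    using e by (metis carrier_matD eq_matI index_zero_mat)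
  define u where "u = e *\<^sub>v unit_vec n j"
  have u: "u \<in> carrier_vec m" using e by (simp add: u_def)
  have "u $ i \<noteq> 0" using e ij by (simp add: u_def)
  then have u0: "u \<noteq> 0\<^sub>v m" using ij by auto
  \<comment> \<open>Column \<open>j\<close> of the identity e A e = e says that e A fixes
    \<open>u\<close>. In particular A u \<noteq> 0, which the regularity of the outer products
    requires.\<close>
  have "e *\<^sub>v (A *\<^sub>v u) = (e * A * e) *\<^sub>v unit_vec n j"
    unfolding u_def using A e(1)
    by (simp add: assoc_mult_mat_vec_dim mult_mat_assoc_dim)
  then have eAu: "e *\<^sub>v (A *\<^sub>v u) = u" by (simp add: e(2) u_def)
  have "e *\<^sub>v 0\<^sub>v n = 0\<^sub>v m" using e(1) by (intro eq_vecI) auto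
  then have Au: "A *\<^sub>v u \<noteq> 0\<^sub>v n" using eAu u0 by auto
  have "outer u ` reg_vecs n m A \<subseteq> (\<lambda>X. e * A * X) ` reg_carrier m n A"
  proof
    fix X assume "X \<in> outer u ` reg_vecs n m A"
    then obtain w where w: "w \<in> reg_vecs n m A" "X = outer u w" by blast
    have "e * A * outer u w = outer u w"
      using A e(1) u eAu by (simp add: mult_outer[of _ m m] assoc_mult_mat_vec_dim mult_mat_assoc_dim)
    then show "X \<in> (\<lambda>X. e * A * X) ` reg_carrier m n A"
      using w outer_reg_vecs_in_reg_carrier[OF A u Au w(1)] by (metis image_eqI)
  qed
  then have "card (outer u ` reg_vecs n m A) \<le> card ((\<lambda>X. e * A * X) ` reg_carrier m n A)"
    by (intro card_mono finite_imageI finite_reg_carrier)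
  moreover have "inj_on (outer u) (reg_vecs n m A)"
    by (rule inj_on_subset[OF inj_outer[OF u u0]]) (auto simp: reg_vecs_def)
  ultimately show ?thesis by (simp add: card_image)
qed

text \<open>The scalar multiples of \<open>e\<close> lie in eRe and are pairwise distinct, as some
  entry of \<open>e\<close> is nonzero.\<close>

lemma card_field_le_card_local_monoid:
  fixes A :: "'a::{field,finite} mat"
  assumes A: "A \<in> carrier_mat n m" and e: "e \<in> carrier_mat m n" "e * A * e = e" "e \<noteq> 0\<^sub>m m n"
  shows "CARD('a) \<le> card ((\<lambda>X. e * A * X * A * e) ` reg_carrier m n A)"
proof -
  obtain i j where ij: "i < m" "j < n" "e $$ (i, j) \<noteq> 0"
    using e by (metis carrier_matD eq_matI index_zero_mat)
  have "inj (\<lambda>c. c \<cdot>\<^sub>m e)"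
  proof (rule injI)
    fix c d assume "c \<cdot>\<^sub>m e = d \<cdot>\<^sub>m e"
    then have "(c \<cdot>\<^sub>m e) $$ (i, j) = (d \<cdot>\<^sub>m e) $$ (i, j)" by simp
    then show "c = d" using ij e(1) by simp
  qed
  moreover have "range (\<lambda>c. c \<cdot>\<^sub>m e) \<subseteq> (\<lambda>X. e * A * X * A * e) ` reg_carrier m n A"
  proof
    fix X assume "X \<in> range (\<lambda>c. c \<cdot>\<^sub>m e)"
    then obtain c where c: "X = c \<cdot>\<^sub>m e" by blast
    have "e * A * (c \<cdot>\<^sub>m e) * A * e = c \<cdot>\<^sub>m (e * A * e * A * e)"
      using A e(1) by (simp add: smult_mult_dim mult_mat_assoc_dim)
    then have "e * A * (c \<cdot>\<^sub>m e) * A * e = c \<cdot>\<^sub>m e" by (simp add: e(2))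
    then show "X \<in> (\<lambda>X. e * A * X * A * e) ` reg_carrier m n A"
      unfolding c by (rule image_eqI[OF sym smult_in_reg_carrier[OF A e(1,2)]])
  qed
  then have "card (range (\<lambda>c. c \<cdot>\<^sub>m e)) \<le> card ((\<lambda>X. e * A * X * A * e) ` reg_carrier m n A)"
    by (intro card_mono finite_imageI finite_reg_carrier)
  ultimately show ?thesis by (simp add: card_image)
qed

lemma transpose_in_reg_carrier:
  assumes A: "A \<in> carrier_mat n m" and X: "X \<in> reg_carrier m n A"
  shows "X\<^sup>T \<in> reg_carrier n m A\<^sup>T"
proof -
  obtain Y where XY: "X \<in> carrier_mat m n" "Y \<in> carrier_mat m n" and eq: "X = X * A * Y * A * X"
    using X by (auto simp: carrier_Reg_sandwich)
  have "X\<^sup>T = (X * (A * (Y * (A * X))))\<^sup>T"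
    using eq A XY by (simp add: mult_mat_assoc_dim)
  also have "\<dots> = X\<^sup>T * A\<^sup>T * Y\<^sup>T * A\<^sup>T * X\<^sup>T"
    using A XY by (simp add: transpose_mult_dim mult_mat_assoc_dim)
  finally show ?thesis using XY by (auto simp: carrier_Reg_sandwich)
qed

text \<open>Transposition is an anti-isomorphism onto the regular part for the transposed sandwich
  matrix. Bounds for left ideals are thus bounds for right ideals with \<open>m\<close> and
  \<open>n\<close> exchanged.\<close>

lemma card_left_ideal_eq_transpose:
  fixes A :: "'a::field mat"
  assumes A: "A \<in> carrier_mat n m" and e: "e \<in> carrier_mat m n"
  shows "card ((\<lambda>X. X * A * e) ` reg_carrier m n A) =
    card ((\<lambda>X. e\<^sup>T * A\<^sup>T * X) ` reg_carrier n m A\<^sup>T)"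
proof -
  have "reg_carrier n m A\<^sup>T = transpose_mat ` reg_carrier m n A"
  proof
    show "transpose_mat ` reg_carrier m n A \<subseteq> reg_carrier n m A\<^sup>T"
      using transpose_in_reg_carrier[OF A] by blast
    show "reg_carrier n m A\<^sup>T \<subseteq> transpose_mat ` reg_carrier m n A"
    proof
      fix X assume "X \<in> reg_carrier n m A\<^sup>T"
      then have "X\<^sup>T \<in> reg_carrier m n A"
        using transpose_in_reg_carrier[of "A\<^sup>T" m n X] A by simp
      then show "X \<in> transpose_mat ` reg_carrier m n A" by (metis image_eqI transpose_transpose)
    qed
  qed
  moreover have "(X * A * e)\<^sup>T = e\<^sup>T * A\<^sup>T * X\<^sup>T" if "X \<in> reg_carrier m n A" for X
  proof -
    have "X \<in> carrier_mat m n" using that reg_carrier_subset by blast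
    then show ?thesis using A e by (simp add: transpose_mult_dim mult_mat_assoc_dim)
  qed
  ultimately have "(\<lambda>X. e\<^sup>T * A\<^sup>T * X) ` reg_carrier n m A\<^sup>T =
      transpose_mat ` (\<lambda>X. X * A * e) ` reg_carrier m n A"
    by (simp add: image_image cong: image_cong_simp)
  moreover have "inj transpose_mat" by (metis injI transpose_transpose)
  ultimately show ?thesis
    by (metis card_image inj_on_subset subset_UNIV)
qed

text \<open>Each element of the ideal is u v^T with v = X^T A^T w. Regularity of \<open>X\<close>
  makes A^T injective on the image of X^T, so \<open>v\<close> is either zero or not annihilated by
  A^T.\<close>

lemma card_right_ideal_outer_le:
  fixes A :: "'a::{field,finite} mat"
  assumes A: "A \<in> carrier_mat n m" and u: "u \<in> carrier_vec m" and w: "w \<in> carrier_vec n"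
  shows "(\<lambda>X. outer u w * A * X) ` reg_carrier m n A \<subseteq> outer u ` reg_vecs n m A"
proof
  fix Z assume "Z \<in> (\<lambda>X. outer u w * A * X) ` reg_carrier m n A"
  then obtain X where X: "X \<in> reg_carrier m n A" and Z: "Z = outer u w * A * X" by blast
  obtain Y where XY: "X \<in> carrier_mat m n" "Y \<in> carrier_mat m n" and eq: "X = X * A * Y * A * X"
    using X by (auto simp: carrier_Reg_sandwich)
  define x where "x = A\<^sup>T *\<^sub>v w"
  have x: "x \<in> carrier_vec m" using A w by (simp add: x_def)
  have "Z = outer u (X\<^sup>T *\<^sub>v x)"
    unfolding Z x_def using A u w XY by (simp add: outer_mult[of _ n m] outer_mult[of _ m n])
  moreover have "X\<^sup>T *\<^sub>v x \<in> reg_vecs n m A"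
  proof -
    have "X\<^sup>T *\<^sub>v x = 0\<^sub>v n" if zero: "A\<^sup>T *\<^sub>v (X\<^sup>T *\<^sub>v x) = 0\<^sub>v m"
    proof -
      have "X = X * (A * (Y * A * X))"
        using eq A XY by (simp add: mult_mat_assoc_dim)
      then have "X\<^sup>T = (X * (A * (Y * A * X)))\<^sup>T" by simp
      also have "\<dots> = (Y * A * X)\<^sup>T * A\<^sup>T * X\<^sup>T"
        using A XY by (simp add: transpose_mult_dim mult_mat_assoc_dim)
      finally have XT: "X\<^sup>T = (Y * A * X)\<^sup>T * A\<^sup>T * X\<^sup>T" .
      have "X\<^sup>T *\<^sub>v x = (Y * A * X)\<^sup>T * A\<^sup>T * X\<^sup>T *\<^sub>v x"
        by (rule arg_cong[OF XT])
      also have "\<dots> = (Y * A * X)\<^sup>T *\<^sub>v (A\<^sup>T *\<^sub>v (X\<^sup>T *\<^sub>v x))"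
        using A XY x by (simp add: assoc_mult_mat_vec_dim mult_mat_assoc_dim)
      also have "\<dots> = 0\<^sub>v n" unfolding zero using A XY by (intro eq_vecI) auto
      finally show ?thesis .
    qed
    then show ?thesis using XY x by (auto simp: reg_vecs_def)
  qed
  ultimately show "Z \<in> outer u ` reg_vecs n m A" by blast
qed

lemma finite_reg_vecs: "finite (reg_vecs n m (A :: 'a::{field,finite} mat))"
  by (rule finite_subset[OF _ finite_carrier_vec]) (auto simp: reg_vecs_def)

text \<open>If w^T A u = 1, then u w^T is idempotent for the sandwich product. A single such element
  meets all three upper bounds.\<close>

lemma rank_one_idempotent:
  fixes A :: "'a::{field,finite} mat"
  assumes A: "A \<in> carrier_mat n m" and nz: "A \<noteq> 0\<^sub>m n m"
  obtains e where "e \<in> reg_carrier m n A" "e * A * e = e" "e \<noteq> 0\<^sub>m m n"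
    "card ((\<lambda>X. e * A * X) ` reg_carrier m n A) \<le> card (reg_vecs n m A)"
    "card ((\<lambda>X. X * A * e) ` reg_carrier m n A) \<le> card (reg_vecs m n A\<^sup>T)"
    "card ((\<lambda>X. e * A * X * A * e) ` reg_carrier m n A) \<le> CARD('a)"
proof -
  obtain i j where ij: "i < n" "j < m" "A $$ (i, j) \<noteq> 0"
    using A nz by (metis carrier_matD eq_matI index_zero_mat)
  \<comment> \<open>The unit vector selects column \<open>j\<close> of \<open>A\<close>, which is
    nonzero because of the entry (i, j).\<close>
  define u where "u = (unit_vec m j :: 'a vec)"
  have u: "u \<in> carrier_vec m" by (simp add: u_def)
  have Auc: "A *\<^sub>v u \<in> carrier_vec n" using A u by simp
  have "(A *\<^sub>v u) $ i \<noteq> 0" using A ij by (simp add: u_def)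
  then have Au: "A *\<^sub>v u \<noteq> 0\<^sub>v n" using ij by auto
  obtain w where w: "w \<in> carrier_vec n" "w \<bullet> (A *\<^sub>v u) = 1"
    using vec_nonzero_scalar_prod[OF Auc Au] by blast
  have Awu: "(A\<^sup>T *\<^sub>v w) \<bullet> u = 1" using transpose_vec_mult_scalar[OF A u w(1)] w by simp
  have Awc: "A\<^sup>T *\<^sub>v w \<in> carrier_vec m" using A w by simp
  have Aw: "A\<^sup>T *\<^sub>v w \<noteq> 0\<^sub>v m" using Awu u by auto
  have u0: "u \<noteq> 0\<^sub>v m" using Awu Awc by auto
  have w0: "w \<noteq> 0\<^sub>v n" using w Auc by auto
  let ?e = "outer u w"
  have e: "?e \<in> carrier_mat m n" using u w by simp
  show thesis
  proof (rule that)
    show "?e \<in> reg_carrier m n A" by (rule outer_in_reg_carrier[OF A u Au w(1) Aw])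
    show "?e * A * ?e = ?e"
      using A w u by (simp add: outer_mult outer_mult_outer[OF Awc u] Awu one_smult_mat)
    show "?e \<noteq> 0\<^sub>m m n" by (rule outer_nonzero[OF u u0 w(1) w0])
    show "card ((\<lambda>X. ?e * A * X) ` reg_carrier m n A) \<le> card (reg_vecs n m A)"
      using card_mono[OF finite_imageI[OF finite_reg_vecs] card_right_ideal_outer_le[OF A u w(1)]]
        card_image_le[OF finite_reg_vecs, of "outer u" n m A] by simp
    \<comment> \<open>The transposed idempotent is again an outer product, with \<open>u\<close> and
      \<open>w\<close> exchanged, so the right ideal bound applies to it.\<close>
    have "card ((\<lambda>X. outer w u * A\<^sup>T * X) ` reg_carrier n m A\<^sup>T) \<le> card (reg_vecs m n A\<^sup>T)"
      using card_mono[OF finite_imageI[OF finite_reg_vecs] card_right_ideal_outer_le[of "A\<^sup>T" m n w u]]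
        card_image_le[OF finite_reg_vecs, of "outer w" m n "A\<^sup>T"] A u w(1) by simp
    then show "card ((\<lambda>X. X * A * ?e) ` reg_carrier m n A) \<le> card (reg_vecs m n A\<^sup>T)"
      by (simp add: card_left_ideal_eq_transpose[OF A e] transpose_outer)
    \<comment> \<open>Between the outer factors stands the scalar w^T A X A u, so eRe consists of
      scalar multiples of e.\<close>
    have "(\<lambda>X. ?e * A * X * A * ?e) ` reg_carrier m n A \<subseteq> range (\<lambda>c. c \<cdot>\<^sub>m ?e)"
    proof
      fix Z assume "Z \<in> (\<lambda>X. ?e * A * X * A * ?e) ` reg_carrier m n A"
      then obtain X where X: "X \<in> carrier_mat m n" and Z: "Z = ?e * A * X * A * ?e"
        using reg_carrier_subset by blast
      define v where "v = X\<^sup>T *\<^sub>v (A\<^sup>T *\<^sub>v w)"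
      have v: "v \<in> carrier_vec n" using X Awc by (simp add: v_def)
      have "Z = outer u v * A * ?e"
        unfolding Z v_def using A X w Awc by (simp add: outer_mult[of _ n m] outer_mult[of _ m n])
      also have "\<dots> = ((A\<^sup>T *\<^sub>v v) \<bullet> u) \<cdot>\<^sub>m ?e"
        using A u v by (simp add: outer_mult[of _ n m] outer_mult_outer[of _ m])
      finally show "Z \<in> range (\<lambda>c. c \<cdot>\<^sub>m ?e)" by blast
    qed
    then have "card ((\<lambda>X. ?e * A * X * A * ?e) ` reg_carrier m n A) \<le> card (range (\<lambda>c::'a. c \<cdot>\<^sub>m ?e))"
      by (intro card_mono) auto
    also have "\<dots> \<le> CARD('a)" by (rule card_image_le) simp
    finally show "card ((\<lambda>X. ?e * A * X * A * ?e) ` reg_carrier m n A) \<le> CARD('a)" .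
  qed
qed

section \<open>Invariants of the regular part\<close>

text \<open>A rank one idempotent \<open>e\<close> on the side of \<open>A\<close> is carried to a
  nonzero idempotent on the side of \<open>B\<close>. Its ideals there are images of those of
  \<open>e\<close>, so the lower bounds for \<open>B\<close> meet the upper bounds for
  \<open>A\<close>.\<close>

lemma Reg_sandwich_iso_bounds:
  fixes A :: "'a::{field,finite} mat" and B :: "'b::{field,finite} mat"
  assumes A: "A \<in> carrier_mat n m" "A \<noteq> 0\<^sub>m n m" and B: "B \<in> carrier_mat l k"
    and iso: "Reg (sandwich m n A) \<cong>\<^sub>s Reg (sandwich k l B)"
  shows "B \<noteq> 0\<^sub>m l k" and "CARD('b) \<le> CARD('a)"
    and "card (reg_vecs l k B) \<le> card (reg_vecs n m A)"
    and "card (reg_vecs k l B\<^sup>T) \<le> card (reg_vecs m n A\<^sup>T)"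
proof -
  let ?R = "reg_carrier m n A" and ?R' = "reg_carrier k l B"
  obtain h where h: "bij_betw h ?R ?R'"
    and hom: "\<And>X Y. X \<in> ?R \<Longrightarrow> Y \<in> ?R \<Longrightarrow> h (X * A * Y) = h X * B * h Y"
    using iso unfolding semigrp_iso_def by auto
  have inj: "inj_on h ?R" and surj: "?R' = h ` ?R" using h by (auto simp: bij_betw_def)
  have closed: "X * A * Y \<in> ?R" if "X \<in> ?R" "Y \<in> ?R" for X Y
    using semigrp.op_closed[OF semigrp_Reg_sandwich[OF A(1)] that] by simp
  obtain e where e: "e \<in> ?R" "e * A * e = e" "e \<noteq> 0\<^sub>m m n"
    and right: "card ((\<lambda>X. e * A * X) ` ?R) \<le> card (reg_vecs n m A)"
    and left: "card ((\<lambda>X. X * A * e) ` ?R) \<le> card (reg_vecs m n A\<^sup>T)"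
    and local: "card ((\<lambda>X. e * A * X * A * e) ` ?R) \<le> CARD('a)"
    using rank_one_idempotent[OF A] by blast
  note zero = zero_in_reg_carrier[OF A(1)] zero_in_reg_carrier[OF B]
  have he: "h e \<in> ?R'" using e surj by blast
  have hec: "h e \<in> carrier_mat k l" using he reg_carrier_subset by blast
  have idem: "h e * B * h e = h e" using hom[OF e(1) e(1)] e(2) by simp
  \<comment> \<open>A preimage \<open>z\<close> of zero shows that zero goes to zero: the product of
    0 and \<open>z\<close> is 0, and its image is a product with zero. Hence h e \<noteq> 0 by
    injectivity.\<close>
  obtain z where z: "z \<in> ?R" "h z = 0\<^sub>m k l" using zero(2) surj by (metis imageE)
  have "z \<in> carrier_mat m n" using z reg_carrier_subset by blast
  then have "h (0\<^sub>m m n) = h (0\<^sub>m m n) * B * h z"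
    using hom[OF zero(1) z(1)] A by simp
  moreover have "h (0\<^sub>m m n) \<in> carrier_mat k l" using zero(1) surj reg_carrier_subset by blast
  ultimately have "h (0\<^sub>m m n) = 0\<^sub>m k l" using z(2) B by simp
  then have ne: "h e \<noteq> 0\<^sub>m k l" using inj_onD[OF inj _ e(1) zero(1)] e(3) by auto
  show "B \<noteq> 0\<^sub>m l k"
  proof
    assume "B = 0\<^sub>m l k"
    then have "h e * B * h e = 0\<^sub>m k l" using hec by simp
    then show False using idem ne by simp
  qed
  have fin: "finite ((\<lambda>X. f X) ` ?R)" for f :: "'a mat \<Rightarrow> 'a mat"
    by (rule finite_imageI[OF finite_reg_carrier])
  have "(\<lambda>X. h e * B * X) ` ?R' = h ` (\<lambda>X. e * A * X) ` ?R"
    unfolding surj image_image by (rule image_cong) (simp_all add: hom e(1))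
  then have "card ((\<lambda>X. h e * B * X) ` ?R') \<le> card ((\<lambda>X. e * A * X) ` ?R)"
    by (simp only: card_image_le[OF fin])
  then show "card (reg_vecs l k B) \<le> card (reg_vecs n m A)"
    using reg_vecs_le_card_right_ideal[OF B hec idem ne] right by linarith
  have "(\<lambda>X. X * B * h e) ` ?R' = h ` (\<lambda>X. X * A * e) ` ?R"
    unfolding surj image_image by (rule image_cong) (simp_all add: hom e(1))
  then have "card ((\<lambda>X. X * B * h e) ` ?R') \<le> card ((\<lambda>X. X * A * e) ` ?R)"
    by (simp only: card_image_le[OF fin])
  moreover have "card (reg_vecs k l B\<^sup>T) \<le> card ((\<lambda>X. X * B * h e) ` ?R')"
    unfolding card_left_ideal_eq_transpose[OF B hec]
  proof (rule reg_vecs_le_card_right_ideal)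
    show "(h e)\<^sup>T * B\<^sup>T * (h e)\<^sup>T = (h e)\<^sup>T"
      using arg_cong[OF idem, of transpose_mat] B hec by (simp add: transpose_mult_dim mult_mat_assoc_dim)
    show "(h e)\<^sup>T \<noteq> 0\<^sub>m l k"
      using ne by (metis transpose_transpose zero_transpose_mat)
  qed (use B hec in auto)
  ultimately show "card (reg_vecs k l B\<^sup>T) \<le> card (reg_vecs m n A\<^sup>T)"
    using left by linarith
  have "(\<lambda>X. h e * B * X * B * h e) ` ?R' = h ` (\<lambda>X. e * A * X * A * e) ` ?R"
    unfolding surj image_image by (rule image_cong) (simp_all add: hom e(1) closed)
  then have "card ((\<lambda>X. h e * B * X * B * h e) ` ?R') \<le> card ((\<lambda>X. e * A * X * A * e) ` ?R)"
    by (simp only: card_image_le[OF fin])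
  then show "CARD('b) \<le> CARD('a)"
    using card_field_le_card_local_monoid[OF B hec idem ne] local by linarith
qed

lemma transpose_diag_ones: "(diag_ones n m r)\<^sup>T = diag_ones m n r"
  by (rule eq_matI) (auto simp: diag_ones_def)

text \<open>Exactly the q^(n-r) - 1 nonzero kernel vectors of the transposed normal form are left
  out. The additive form avoids truncated subtraction.\<close>

lemma card_reg_vecs_diag_ones:
  assumes r: "r \<le> n" "r \<le> m"
  shows "card (reg_vecs n m (diag_ones n m r :: 'a::{field,finite} mat)) + CARD('a) ^ (n - r) = CARD('a) ^ n + 1"
proof -
  let ?C = "carrier_vec n :: 'a vec set"
  let ?K = "{w \<in> carrier_vec n. \<forall>i<n. \<not> r \<le> i \<longrightarrow> w $ i = (0 :: 'a)}"
  have "diag_ones m n r *\<^sub>v w = 0\<^sub>v m \<longleftrightarrow> w \<in> ?K" if w: "w \<in> ?C" for w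
  proof
    note eq = diag_ones_mult_vec[OF w r(1), of m]
    show "w \<in> ?K" if "diag_ones m n r *\<^sub>v w = 0\<^sub>v m"
    proof -
      have "w $ i = 0" if "i < r" for i
        using arg_cong[OF \<open>diag_ones m n r *\<^sub>v w = 0\<^sub>v m\<close>, of "\<lambda>v. v $ i"] that r by (simp add: eq)
      then show ?thesis using w by simp
    qed
    show "diag_ones m n r *\<^sub>v w = 0\<^sub>v m" if "w \<in> ?K"
      unfolding eq by (rule eq_vecI) (use that r in simp_all)
  qed
  then have eq: "reg_vecs n m (diag_ones n m r) = ?C - (?K - {0\<^sub>v n})"
    unfolding reg_vecs_def transpose_diag_ones by auto
  have fin: "finite ?C" by (rule finite_carrier_vec)
  have KC: "?K \<subseteq> ?C" by (rule Collect_restrict)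
  have zK: "0\<^sub>v n \<in> ?K" by simp
  have finK: "finite ?K" by (rule finite_subset[OF KC fin])
  have sub: "?K - {0\<^sub>v n} \<subseteq> ?C" using KC by (rule order_trans[OF Diff_subset])
  have "card (reg_vecs n m (diag_ones n m r :: 'a mat)) = card ?C - card (?K - {0\<^sub>v n})"
    unfolding eq by (rule card_Diff_subset[OF finite_Diff[OF finK] sub])
  moreover have "card (?K - {0\<^sub>v n}) \<le> card ?C" by (rule card_mono[OF fin sub])
  moreover have "card ?K = Suc (card (?K - {0\<^sub>v n}))"
    by (rule card_Suc_Diff1[OF finK zK, symmetric])
  moreover have "card ?K = CARD('a) ^ (n - r)"
  proof -
    have "{i. i < n \<and> r \<le> i} = {r..<n}" by auto
    then show ?thesis by (simp add: card_vec_support)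
  qed
  moreover have "card ?C = CARD('a) ^ n"
    using card_vec_support[of n "\<lambda>_. True", where 'a = 'a] by simp
  ultimately show ?thesis by linarith
qed

text \<open>This is q^n - q^(n-r) = q^l - q^(l-s) in additive form, with a = n - r and b = l - s. If
  a < b, division by q^a leaves a multiple of \<open>q\<close> on the left, because r \<ge> 1, and a
  number congruent to 1 modulo \<open>q\<close> on the right.\<close>

lemma power_add_power_unique:
  fixes q :: nat
  assumes q: "q \<ge> 2" and r: "r \<ge> 1" and s: "s \<ge> 1"
    and eq: "q ^ (a + r) + q ^ b = q ^ (b + s) + q ^ a"
  shows "a = b \<and> r = s"
proof -
  have not_less: "\<not> a < b" if *: "q ^ (a + r) + q ^ b = q ^ (b + s) + q ^ a" "r \<ge> 1" for a b r s
  proof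
    assume "a < b"
    then obtain d where d: "b = a + Suc d" using less_iff_Suc_add by auto
    obtain r' where r': "r = Suc r'" using *(2) by (cases r) auto
    have mult_eq: "q ^ a * (q ^ r + q ^ Suc d) = q ^ a * (q ^ (Suc d + s) + 1)"
      using *(1) unfolding d by (simp add: power_add algebra_simps)
    have "q ^ r + q ^ Suc d = q ^ (Suc d + s) + 1"
      by (rule nat_mult_eq_cancel1[THEN iffD1, OF _ mult_eq]) (use q in simp)
    then have "q * (q ^ r' + q ^ d) = q * q ^ (d + s) + 1" by (simp add: r' algebra_simps)
    then have "q dvd q * q ^ (d + s) + 1" by (metis dvd_triv_left)
    then have "q dvd 1" by (rule dvd_add_right_iff[THEN iffD1, rotated]) simp
    then show False using q by simp
  qed
  have "a = b" using not_less[OF eq r] not_less[OF eq[symmetric] s] by simp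
  then show ?thesis using eq q by (simp add: power_inject_exp)
qed

lemma Reg_sandwich_iso_invariants:
  fixes A :: "'a::{field,finite} mat" and B :: "'b::{field,finite} mat"
  assumes A: "A \<in> carrier_mat n m" and r: "vec_space.rank n A = r" "r \<ge> 1"
    and B: "B \<in> carrier_mat l k" and s: "vec_space.rank l B = s"
    and iso: "Reg (sandwich m n A) \<cong>\<^sub>s Reg (sandwich k l B)"
  shows "r = s \<and> m = k \<and> n = l \<and> CARD('a) = CARD('b)"
proof -
  let ?J = "diag_ones n m r :: 'a mat" and ?K = "diag_ones l k s :: 'b mat"
  have rn: "r \<le> n" "r \<le> m" and eqA: "mat_equiv n m A ?J"
    using rank_mat_equiv_diag_ones[OF A] r by auto
  have sl: "s \<le> l" "s \<le> k" and eqB: "mat_equiv l k B ?K"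
    using rank_mat_equiv_diag_ones[OF B] s by auto
  \<comment> \<open>The sizes of \<open>reg_vecs\<close> are known for normal forms, so the
    isomorphism is moved there.\<close>
  have "Reg (sandwich m n ?J) \<cong>\<^sub>s Reg (sandwich m n A)"
    using semigrp_iso_Reg[OF semigrp_sandwich[OF diag_ones_carrier] sandwich_iso_mat_equiv[OF mat_equiv_sym[OF eqA]]] .
  moreover have "Reg (sandwich k l B) \<cong>\<^sub>s Reg (sandwich k l ?K)"
    using semigrp_iso_Reg[OF semigrp_sandwich[OF B] sandwich_iso_mat_equiv[OF eqB]] .
  ultimately have iso': "Reg (sandwich m n ?J) \<cong>\<^sub>s Reg (sandwich k l ?K)"
    using iso by (blast intro: semigrp_iso_trans)
  have iso'': "Reg (sandwich k l ?K) \<cong>\<^sub>s Reg (sandwich m n ?J)"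
    using semigrp_iso_sym[OF semigrp_Reg_sandwich[OF diag_ones_carrier] iso'] .
  have "?J $$ (0, 0) = 1" using rn r by (simp add: diag_ones_def)
  then have J: "?J \<noteq> 0\<^sub>m n m" using rn r by auto
  note 1 = Reg_sandwich_iso_bounds[OF diag_ones_carrier J diag_ones_carrier iso']
  \<comment> \<open>The bounds in the reverse direction presuppose that \<open>?K\<close> is
    nonzero, which is the first conclusion of the forward application.\<close>
  note 2 = Reg_sandwich_iso_bounds[OF diag_ones_carrier 1(1) diag_ones_carrier iso'']
  have q: "CARD('a) = CARD('b)" using 1(2) 2(2) by simp
  have s1: "s \<ge> 1"
  proof (rule ccontr)
    assume "\<not> s \<ge> 1"
    then have "?K = 0\<^sub>m l k" by (intro eq_matI) (auto simp: diag_ones_def)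
    then show False using 1(1) by simp
  qed
  have "card {0, 1 :: 'a} \<le> CARD('a)" by (rule card_mono) auto
  then have q2: "CARD('b) \<ge> 2" by (simp add: q)
  have "card (reg_vecs n m ?J) = card (reg_vecs l k ?K)" using 1(3) 2(3) by simp
  \<comment> \<open>The exponents n and l are split as n - r + r and l - s + s to fit the uniqueness
    of exponents.\<close>
  then have "CARD('b) ^ (n - r + r) + CARD('b) ^ (l - s) = CARD('b) ^ (l - s + s) + CARD('b) ^ (n - r)"
    using card_reg_vecs_diag_ones[OF rn, where 'a = 'a] card_reg_vecs_diag_ones[OF sl, where 'a = 'b]
      rn sl by (simp add: q)
  from power_add_power_unique[OF q2 r(2) s1 this] have nl: "n - r = l - s" "r = s" by auto
  have "card (reg_vecs m n (diag_ones m n r :: 'a mat)) = card (reg_vecs k l (diag_ones k l s :: 'b mat))"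
    using 1(4) 2(4) by (simp add: transpose_diag_ones)
  then have "CARD('b) ^ (m - r + r) + CARD('b) ^ (k - s) = CARD('b) ^ (k - s + s) + CARD('b) ^ (m - r)"
    using card_reg_vecs_diag_ones[OF rn(2,1), where 'a = 'a]
      card_reg_vecs_diag_ones[OF sl(2,1), where 'a = 'b] rn sl by (simp add: q)
  from power_add_power_unique[OF q2 r(2) s1 this] have "m - r = k - s" by auto
  with nl rn sl q show ?thesis by auto
qed

text \<open>All products are zero, so any bijection that sends zero to zero is an
  isomorphism.\<close>

lemma sandwich_zero_iso:
  fixes A :: "'a::{field,finite} mat" and B :: "'b::{field,finite} mat"
  assumes A: "A = 0\<^sub>m n m" and B: "B = 0\<^sub>m l k" and card: "CARD('a) ^ (m * n) = CARD('b) ^ (k * l)"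
  shows "sandwich m n A \<cong>\<^sub>s sandwich k l B"
proof -
  let ?S = "carrier_mat m n :: 'a mat set" and ?T = "carrier_mat k l :: 'b mat set"
  have "card (?S - {0\<^sub>m m n}) = card (?T - {0\<^sub>m k l})"
    using card by (simp add: card_Diff_singleton card_carrier_mat)
  then obtain g where g: "bij_betw g (?S - {0\<^sub>m m n}) (?T - {0\<^sub>m k l})"
    using finite_same_card_bij[OF finite_Diff[OF finite_carrier_mat] finite_Diff[OF finite_carrier_mat]]
    by blast
  define h where "h X = (if X = 0\<^sub>m m n then 0\<^sub>m k l else g X)" for X
  have "bij_betw h (?S - {0\<^sub>m m n} \<union> {0\<^sub>m m n}) (?T - {0\<^sub>m k l} \<union> {0\<^sub>m k l})"
  proof (rule bij_betw_combine)
    show "bij_betw h (?S - {0\<^sub>m m n}) (?T - {0\<^sub>m k l})"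
      using g by (rule bij_betw_cong[THEN iffD1, rotated]) (simp add: h_def)
    show "bij_betw h {0\<^sub>m m n} {0\<^sub>m k l}" by (simp add: bij_betw_def h_def)
  qed simp
  moreover have "?S - {0\<^sub>m m n} \<union> {0\<^sub>m m n} = ?S" "?T - {0\<^sub>m k l} \<union> {0\<^sub>m k l} = ?T" by auto
  ultimately have bij: "bij_betw h ?S ?T" by simp
  have "h (X * A * Y) = h X * B * h Y" if "X \<in> ?S" "Y \<in> ?S" for X Y
  proof -
    have "h X \<in> ?T" "h Y \<in> ?T" using bij that by (auto simp: bij_betw_def)
    then show ?thesis using that by (simp add: A B h_def)
  qed
  then show ?thesis
    unfolding semigrp_iso_def carrier_sandwich op_sandwich using bij by blast
qed

theorem theorem6p5:
  fixes A :: "'a::{field,finite} mat" and B :: "'b::{field,finite} mat"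
    and m n k l r s q1 q2 :: nat
  assumes "card (UNIV :: 'a set) = q1" and "card (UNIV :: 'b set) = q2"
    and "m \<ge> 1" and "n \<ge> 1" and "k \<ge> 1" and "l \<ge> 1"
    and "A \<in> carrier_mat n m" and "vec_space.rank n A = r"
    and "B \<in> carrier_mat l k" and "vec_space.rank l B = s"
  shows "(sandwich m n A \<cong>\<^sub>s sandwich k l B \<longleftrightarrow>
           (r = 0 \<and> s = 0 \<and> q1 ^ (m * n) = q2 ^ (k * l)) \<or>
           (r = s \<and> s \<ge> 1 \<and> (m, n) = (k, l) \<and> q1 = q2)) \<and>
         (r \<ge> 1 \<longrightarrow>
           (sandwich m n A \<cong>\<^sub>s sandwich k l B \<longleftrightarrow>
            Reg (sandwich m n A) \<cong>\<^sub>s Reg (sandwich k l B)))"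
proof -
  let ?S = "sandwich m n A" and ?T = "sandwich k l B"
  note q = assms(1,2)
  have A: "A \<in> carrier_mat n m" and r: "vec_space.rank n A = r"
    and B: "B \<in> carrier_mat l k" and s: "vec_space.rank l B = s" using assms by auto
  have to_Reg: "Reg ?S \<cong>\<^sub>s Reg ?T" if "?S \<cong>\<^sub>s ?T"
    by (rule semigrp_iso_Reg[OF semigrp_sandwich[OF A] that])
  have from_Reg: "r = s \<and> m = k \<and> n = l \<and> q1 = q2" if "r \<ge> 1" "Reg ?S \<cong>\<^sub>s Reg ?T"
    using Reg_sandwich_iso_invariants[OF A r that(1) B s that(2)] q by simp
  have iso: "?S \<cong>\<^sub>s ?T" if "r = s" "m = k" "n = l" "q1 = q2"
    using that sandwich_iso_of_card_eq[of A n m B] A B r s q by simp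
  have null: "?S \<cong>\<^sub>s ?T \<longleftrightarrow> s = 0 \<and> q1 ^ (m * n) = q2 ^ (k * l)" if "r = 0"
  proof
    assume *: "?S \<cong>\<^sub>s ?T"
    have "s = 0"
    proof (rule ccontr)
      assume "s \<noteq> 0"
      \<comment> \<open>The invariants require positive rank on the first side, so the isomorphism
        is reversed; equality of the ranks then contradicts r = 0.\<close>
      moreover have "Reg ?T \<cong>\<^sub>s Reg ?S"
        by (rule semigrp_iso_Reg[OF semigrp_sandwich[OF B] semigrp_iso_sym[OF semigrp_sandwich[OF A] *]])
      ultimately show False
        using Reg_sandwich_iso_invariants[OF B s _ A r] that by simp
    qed
    moreover have "card (carrier ?S) = card (carrier ?T)"
      using * bij_betw_same_card unfolding semigrp_iso_def by blast
    ultimately show "s = 0 \<and> q1 ^ (m * n) = q2 ^ (k * l)"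
      using q by (simp add: card_carrier_mat)
  next
    assume "s = 0 \<and> q1 ^ (m * n) = q2 ^ (k * l)"
    then show "?S \<cong>\<^sub>s ?T"
      using sandwich_zero_iso[of A n m B l k] rank_0_iff[OF A] rank_0_iff[OF B] r s q that by simp
  qed
  show ?thesis
  proof (cases "r = 0")
    case True
    then show ?thesis using null by auto
  next
    case False
    then show ?thesis using to_Reg from_Reg iso by auto
  qed
qed

end
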